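(* Let $c,h,l,\alpha,\beta,c_1,h_1,l_1,\alpha_1,\beta_1\in\mathbb{C}$ and $\gamma,\gamma_1\in\mathbb{C}^*$. Then: (1) $L(c,h,l)\otimes A'(\alpha,\beta)^{\mathcal{D}}\cong L(c_1,h_1,l_1)\otimes A'(\alpha_1,\beta_1)^{\mathcal{D}}$ as $\mathcal{D}$-modules if and only if $(c,h,l)=(c_1,h_1,l_1)$, $\alpha-\alpha_1\in\mathbb{Z}$, and either $\beta=\beta_1$ or $\{\beta,\beta_1\}=\{0,-1\}$. (2) $L(c,h,l)\otimes A(\alpha,\beta,\gamma)\cong L(c_1,h_1,l_1)\otimes A(\alpha_1,\beta_1,\gamma_1)$ if and only if $(\beta,\gamma,c,h,l)=(\beta_1,\gamma_1,c_1,h_1,l_1)$ and $\alpha-\alpha_1\in\frac12\mathbb{Z}$. (3) $L(c,h,l)\otimes A(\alpha,\beta,\gamma)\not\cong L(c_1,h_1,l_1)\otimes A'(\alpha_1,\beta_1)^{\mathcal{D}}$.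
   Context: The mirror-twisted Heisenberg–Virasoro algebra $\mathcal{D}$ is the complex Lie algebra with basis $\{d_m,h_r,\mathbf{c},\mathbf{l}: m\in\mathbb{Z}, r\in\frac12+\mathbb{Z}\}$ and brackets $[d_m,d_n]=(m-n)d_{m+n}+\frac{m^3-m}{12}\delta_{m+n,0}\mathbf{c}$, $[d_m,h_r]=-rh_{m+r}$, $[h_r,h_s]=r\delta_{r+s,0}\mathbf{l}$, with $\mathbf{c},\mathbf{l}$ central. $\mathcal{V}=\mathrm{span}\{d_m,\mathbf{c}\}$ (Virasoro algebra), $\mathcal{H}=\mathrm{span}\{h_r,\mathbf{l}\}$. $\mathcal{D}^{+}=\mathrm{span}\{d_{n},h_{r}: n\in\mathbb{N}, r\in\frac12+\mathbb{Z}_{\ge0}\}$, $\mathcal{D}^0=\mathrm{span}\{d_0,\mathbf{c},\mathbf{l}\}$. $L(c,h,l)$ is the irreducible quotient of the Verma module $M(c,h,l)=U(\mathcal{D})\otimes_{U(\mathcal{D}^0\oplus\mathcal{D}^+)}\mathbb{C}\mathbf{1}$, where $d_0\mathbf{1}=h\mathbf{1}$, $\mathbf{c}\mathbf{1}=c\mathbf{1}$, $\mathbf{l}\mathbf{1}=l\mathbf{1}$, $\mathcal{D}^+\mathbf{1}=0$. $A(\alpha,\beta,\gamma)$ is the $\mathcal{D}$-module with basis $\{v_k:k\in\frac12\mathbb{Z}\}$ and $d_mv_k=(\alpha+\beta m-k)v_{m+k}$, $h_rv_n=v_{n+r}$ for $n\in\mathbb{Z}$, $h_rv_s=\gamma v_{r+s}$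 for $s\in\frac12+\mathbb{Z}$, $\mathbf{c},\mathbf{l}$ acting as $0$. $A(\alpha,\beta)$ is the $\mathcal{V}$-module with basis $\{v_k:k\in\mathbb{Z}\}$, $d_mv_k=(\alpha+\beta m-k)v_{m+k}$, $\mathbf{c}=0$; $A'(\alpha,\beta)$ is its unique nontrivial irreducible subquotient. For a $\mathcal{V}$-module $V$, $V^{\mathcal{D}}$ is $V$ with $\mathcal{H}$ acting as $0$. Tensor products carry the action $x(v\otimes w)=xv\otimes w+v\otimes xw$. *)

theory Defs
  imports Complex_Main "HOL-Library.Function_Algebras"
begin

text \<open>Basis of the mirror-twisted Heisenberg-Virasoro algebra D:
  Dd m = d_m (m in Z), Dh k = h_(k+1/2) (k in Z), Dc = central c, Dl = central l.\<close>
datatype Dgen = Dd int | Dh int | Dc | Dl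

text \<open>A (representation of D on a) complex vector space: the vector space is the
  whole type 'a with scalar multiplication sc; rho g is the action of the basis
  element g.\<close>

definition lin_op :: "(complex \<Rightarrow> 'a::ab_group_add \<Rightarrow> 'a) \<Rightarrow> ('a \<Rightarrow> 'a) \<Rightarrow> bool" where
  "lin_op sc f \<longleftrightarrow> (\<forall>x y. f (x + y) = f x + f y) \<and> (\<forall>a x. f (sc a x) = sc a (f x))"

definition D_module :: "(complex \<Rightarrow> 'a::ab_group_add \<Rightarrow> 'a) \<Rightarrow> (Dgen \<Rightarrow> 'a \<Rightarrow> 'a) \<Rightarrow> bool" where
  "D_module sc \<rho> \<longleftrightarrow> vector_space sc \<and> (\<forall>g. lin_op sc (\<rho> g)) \<and>
    (\<forall>m n x. \<rho> (Dd m) (\<rho> (Dd n) x) - \<rho> (Dd n) (\<rho> (Dd m) x)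
        = sc (of_int (m - n)) (\<rho> (Dd (m + n)) x)
          + (if m + n = 0 then sc (of_int (m^3 - m) / 12) (\<rho> Dc x) else 0)) \<and>
    (\<forall>m k x. \<rho> (Dd m) (\<rho> (Dh k) x) - \<rho> (Dh k) (\<rho> (Dd m) x)
        = sc (- (of_int k + 1/2)) (\<rho> (Dh (m + k)) x)) \<and>
    (\<forall>k j x. \<rho> (Dh k) (\<rho> (Dh j) x) - \<rho> (Dh j) (\<rho> (Dh k) x)
        = (if k + j + 1 = 0 then sc (of_int k + 1/2) (\<rho> Dl x) else 0)) \<and>
    (\<forall>g x. \<rho> Dc (\<rho> g x) = \<rho> g (\<rho> Dc x) \<and> \<rho> Dl (\<rho> g x) = \<rho> g (\<rho> Dl x))"

definition submodule :: "(complex \<Rightarrow> 'a::ab_group_add \<Rightarrow> 'a) \<Rightarrow> (Dgen \<Rightarrow> 'a \<Rightarrow> 'a) \<Rightarrow> 'a set \<Rightarrow> bool" where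
  "submodule sc \<rho> W \<longleftrightarrow> 0 \<in> W \<and> (\<forall>x\<in>W. \<forall>y\<in>W. x + y \<in> W) \<and> (\<forall>a. \<forall>x\<in>W. sc a x \<in> W)
     \<and> (\<forall>g. \<forall>x\<in>W. \<rho> g x \<in> W)"

definition irreducible_D :: "(complex \<Rightarrow> 'a::ab_group_add \<Rightarrow> 'a) \<Rightarrow> (Dgen \<Rightarrow> 'a \<Rightarrow> 'a) \<Rightarrow> bool" where
  "irreducible_D sc \<rho> \<longleftrightarrow> D_module sc \<rho> \<and> (\<exists>x::'a. x \<noteq> 0) \<and>
     (\<forall>W. submodule sc \<rho> W \<longrightarrow> W = {0} \<or> W = UNIV)"

definition hw_vector :: "(complex \<Rightarrow> 'a::ab_group_add \<Rightarrow> 'a) \<Rightarrow> (Dgen \<Rightarrow> 'a \<Rightarrow> 'a) \<Rightarrow> complex \<Rightarrow> complex \<Rightarrow> complex \<Rightarrow> 'a \<Rightarrow> bool" where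
  "hw_vector sc \<rho> c h l v \<longleftrightarrow> v \<noteq> 0 \<and> \<rho> (Dd 0) v = sc h v \<and> \<rho> Dc v = sc c v \<and> \<rho> Dl v = sc l v
     \<and> (\<forall>n>0. \<rho> (Dd n) v = 0) \<and> (\<forall>k\<ge>0. \<rho> (Dh k) v = 0)"

text \<open>(sc, rho) is (isomorphic to) L(c,h,l): the irreducible highest weight module of
  highest weight (c,h,l), i.e. the irreducible quotient of the Verma module M(c,h,l).\<close>
definition is_L :: "(complex \<Rightarrow> 'a::ab_group_add \<Rightarrow> 'a) \<Rightarrow> (Dgen \<Rightarrow> 'a \<Rightarrow> 'a) \<Rightarrow> complex \<Rightarrow> complex \<Rightarrow> complex \<Rightarrow> bool" where
  "is_L sc \<rho> c h l \<longleftrightarrow> irreducible_D sc \<rho> \<and> (\<exists>v. hw_vector sc \<rho> c h l v)"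

definition mod_iso ::
  "'a::ab_group_add set \<Rightarrow> (complex \<Rightarrow> 'a \<Rightarrow> 'a) \<Rightarrow> (Dgen \<Rightarrow> 'a \<Rightarrow> 'a) \<Rightarrow>
   'b::ab_group_add set \<Rightarrow> (complex \<Rightarrow> 'b \<Rightarrow> 'b) \<Rightarrow> (Dgen \<Rightarrow> 'b \<Rightarrow> 'b) \<Rightarrow> bool" where
  "mod_iso S sc \<rho> T sc' \<sigma> \<longleftrightarrow> (\<exists>\<phi>. bij_betw \<phi> S T \<and>
      (\<forall>x\<in>S. \<forall>y\<in>S. \<phi> (x + y) = \<phi> x + \<phi> y) \<and> (\<forall>a. \<forall>x\<in>S. \<phi> (sc a x) = sc' a (\<phi> x)) \<and>
      (\<forall>g. \<forall>x\<in>S. \<phi> (\<rho> g x) = \<sigma> g (\<phi> x)))"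

definition fsc :: "(complex \<Rightarrow> 'a \<Rightarrow> 'a) \<Rightarrow> complex \<Rightarrow> (int \<Rightarrow> 'a) \<Rightarrow> int \<Rightarrow> 'a" where
  "fsc sc a f = (\<lambda>i. sc a (f i))"

text \<open>V \<otimes> A(alpha,beta,gamma). A has basis v_k, k in (1/2)Z; we index v_k by j = 2k in Z.
  An element sum_j f(j) \<otimes> v_(j/2) is represented by the finitely supported f : int => V.\<close>
definition tensA_carrier :: "(int \<Rightarrow> 'a::zero) set" where
  "tensA_carrier = {f. finite {i. f i \<noteq> 0}}"

definition tensA_act :: "(complex \<Rightarrow> 'a::ab_group_add \<Rightarrow> 'a) \<Rightarrow> (Dgen \<Rightarrow> 'a \<Rightarrow> 'a)
    \<Rightarrow> complex \<Rightarrow> complex \<Rightarrow> complex \<Rightarrow> Dgen \<Rightarrow> (int \<Rightarrow> 'a) \<Rightarrow> int \<Rightarrow> 'a" where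
  "tensA_act sc \<rho> \<alpha> \<beta> \<gamma> g f = (\<lambda>i. case g of
      Dd m \<Rightarrow> \<rho> (Dd m) (f i)
              + sc (\<alpha> + \<beta> * of_int m - of_int (i - 2 * m) / 2) (f (i - 2 * m))
    | Dh k \<Rightarrow> \<rho> (Dh k) (f i)
              + sc (if even (i - (2 * k + 1)) then 1 else \<gamma>) (f (i - (2 * k + 1)))
    | Dc \<Rightarrow> \<rho> Dc (f i)
    | Dl \<Rightarrow> \<rho> Dl (f i))"

text \<open>V \<otimes> A'(alpha,beta)^D. A(alpha,beta) has basis v_k (k in Z); it is reducible exactly when
  alpha in Z and beta in {0,-1}, and then A'(alpha,beta) has basis the images of v_k, k ~= alpha
  (beta = 0: quotient by C v_alpha; beta = -1: submodule spanned by v_k, k ~= alpha).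
  Otherwise A' = A. H acts trivially on A'^D.\<close>
definition Aprime_index :: "complex \<Rightarrow> complex \<Rightarrow> int set" where
  "Aprime_index \<alpha> \<beta> = {k. \<not> (\<alpha> = of_int k \<and> (\<beta> = 0 \<or> \<beta> = -1))}"

definition tensA'_carrier :: "complex \<Rightarrow> complex \<Rightarrow> (int \<Rightarrow> 'a::zero) set" where
  "tensA'_carrier \<alpha> \<beta> = {f. finite {i. f i \<noteq> 0} \<and> {i. f i \<noteq> 0} \<subseteq> Aprime_index \<alpha> \<beta>}"

definition tensA'_act :: "(complex \<Rightarrow> 'a::ab_group_add \<Rightarrow> 'a) \<Rightarrow> (Dgen \<Rightarrow> 'a \<Rightarrow> 'a)
    \<Rightarrow> complex \<Rightarrow> complex \<Rightarrow> Dgen \<Rightarrow> (int \<Rightarrow> 'a) \<Rightarrow> int \<Rightarrow> 'a" where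
  "tensA'_act sc \<rho> \<alpha> \<beta> g f = (\<lambda>i. if i \<in> Aprime_index \<alpha> \<beta> then
     (case g of
      Dd m \<Rightarrow> \<rho> (Dd m) (f i) + sc (\<alpha> + \<beta> * of_int m - of_int (i - m)) (f (i - m))
    | Dh k \<Rightarrow> \<rho> (Dh k) (f i)
    | Dc \<Rightarrow> \<rho> Dc (f i)
    | Dl \<Rightarrow> \<rho> Dl (f i))
    else 0)"

end

theory Submission
  imports Defs "HOL-Library.Product_Plus"
begin

text \<open>
  An isomorphism \<open>\<phi>\<close> is tested on \<open>v \<otimes> v\<^sub>k\<close> with \<open>v\<close> the highest weight vector. For large \<open>m\<close>
  and \<open>r\<close> the elements \<open>d\<^sub>m\<close> and \<open>h\<^sub>r\<close> kill any given vector of an irreducible highest weight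
  module, so on a fixed tensor they act through the second factor only, by explicit scalars.
  Comparing \<open>d\<^sub>m h\<^sub>r\<close> with \<open>h\<^bsub>m+r\<^esub>\<close> (or, when the Heisenberg part acts trivially on the second
  factor, \<open>d\<^sub>n d\<^sub>m\<close> with \<open>d\<^bsub>m+n\<^esub>\<close>) on \<open>v \<otimes> v\<^sub>k\<close> and on its image determines the parameters and
  forces the image to be of the form \<open>w \<otimes> v\<^sub>j\<close>, where \<open>k - j\<close> does not depend on \<open>k\<close>. Then \<open>w\<close> is
  again a highest weight vector, of the same weight as \<open>v\<close>, and the weight of a highest weight
  vector in an irreducible module is unique.
\<close>

section \<open>Highest weight modules\<close>

text \<open>Degrees are doubled, so that \<open>h\<^sub>r\<close> has the integer degree \<open>2r\<close>.\<close>

fun ddeg :: "Dgen \<Rightarrow> int" where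
  "ddeg (Dd m) = 2 * m"
| "ddeg (Dh k) = 2 * k + 1"
| "ddeg Dc = 0"
| "ddeg Dl = 0"

section \<open>Generators and their commutators\<close>

locale D_mod = vector_space sc
  for sc :: "complex \<Rightarrow> 'a::ab_group_add \<Rightarrow> 'a" +
  fixes \<rho> :: "Dgen \<Rightarrow> 'a \<Rightarrow> 'a"
  assumes D_module: "D_module sc \<rho>"
begin

lemma act_add [simp]: "\<rho> g (x + y) = \<rho> g x + \<rho> g y"
  and act_scale [simp]: "\<rho> g (sc a x) = sc a (\<rho> g x)"
  using D_module unfolding D_module_def lin_op_def by blast+

lemma act_zero [simp]: "\<rho> g 0 = 0"
  using act_scale[of g 0 0] by simp

lemma act_sum: "\<rho> g (sum f J) = (\<Sum>j\<in>J. \<rho> g (f j))"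
  by (induction J rule: infinite_finite_induct) auto

lemma Dc_commute: "\<rho> Dc (\<rho> g x) = \<rho> g (\<rho> Dc x)"
  and Dl_commute: "\<rho> Dl (\<rho> g x) = \<rho> g (\<rho> Dl x)"
  using D_module unfolding D_module_def by blast+

lemma bracket_Dd_Dd: "\<rho> (Dd m) (\<rho> (Dd n) x) - \<rho> (Dd n) (\<rho> (Dd m) x)
        = sc (of_int (m - n)) (\<rho> (Dd (m + n)) x)
          + (if m + n = 0 then sc (of_int (m^3 - m) / 12) (\<rho> Dc x) else 0)"
  and bracket_Dd_Dh: "\<rho> (Dd m) (\<rho> (Dh k) x) - \<rho> (Dh k) (\<rho> (Dd m) x)
        = sc (- (of_int k + 1/2)) (\<rho> (Dh (m + k)) x)"
  and bracket_Dh_Dh: "\<rho> (Dh k) (\<rho> (Dh j) x) - \<rho> (Dh j) (\<rho> (Dh k) x)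
        = (if k + j + 1 = 0 then sc (of_int k + 1/2) (\<rho> Dl x) else 0)"
  using D_module unfolding D_module_def by blast+

lemma Dd_Dd: "\<rho> (Dd m) (\<rho> (Dd n) x) = \<rho> (Dd n) (\<rho> (Dd m) x)
        + sc (of_int (m - n)) (\<rho> (Dd (m + n)) x)
        + (if m + n = 0 then sc (of_int (m^3 - m) / 12) (\<rho> Dc x) else 0)"
  using bracket_Dd_Dd[of m n x] by (simp add: diff_eq_eq add_ac)

lemma Dd_Dh: "\<rho> (Dd m) (\<rho> (Dh k) x) = \<rho> (Dh k) (\<rho> (Dd m) x)
        + sc (- (of_int k + 1/2)) (\<rho> (Dh (m + k)) x)"
  using bracket_Dd_Dh[of m k x] by (simp only: diff_eq_eq add_ac)

lemma Dh_Dh: "\<rho> (Dh k) (\<rho> (Dh j) x) = \<rho> (Dh j) (\<rho> (Dh k) x)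
        + (if k + j + 1 = 0 then sc (of_int k + 1/2) (\<rho> Dl x) else 0)"
  using bracket_Dh_Dh[of k j x] by (simp only: diff_eq_eq add_ac)

text \<open>A single shape for all brackets, so that later inductions need only degrees. Two
  correction terms are provided because \<open>[d_m, d_n]\<close> with \<open>m + n = 0\<close> has
  both a \<open>d_0\<close> part and a central part.\<close>

lemma commutator:
  obtains a b g1 g2 where "ddeg g1 = ddeg g + ddeg g'" "ddeg g2 = ddeg g + ddeg g'"
    "\<And>x. \<rho> g (\<rho> g' x) = \<rho> g' (\<rho> g x) + sc a (\<rho> g1 x) + sc b (\<rho> g2 x)"
proof -
  \<comment> \<open>For commuting generators both coefficients are \<open>0\<close>, and any
    generator of the right degree fills the two slots. When one of the two is central, hence of
    degree \<open>0\<close>, the other has that degree.\<close>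
  have central: thesis if "\<And>x. \<rho> g (\<rho> g' x) = \<rho> g' (\<rho> g x)"
      "ddeg g'' = ddeg g + ddeg g'" for g''
    by (rule \<open>\<And>g1 g2 a b. \<lbrakk>ddeg g1 = ddeg g + ddeg g'; ddeg g2 = ddeg g + ddeg g';
      \<And>x. \<rho> g (\<rho> g' x) = \<rho> g' (\<rho> g x) + sc a (\<rho> g1 x) + sc b (\<rho> g2 x)\<rbrakk> \<Longrightarrow> thesis\<close>
        [of g'' g'' 0 0]) (auto simp: that)
  show thesis
  proof (cases g)
    case g: (Dd m)
    show thesis
    proof (cases g')
      case (Dd n)
      show thesis
        by (rule that[of "Dd (m + n)" "if m + n = 0 then Dc else Dd (m + n)" "of_int (m - n)"
              "if m + n = 0 then of_int (m^3 - m) / 12 else 0"])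
          (use Dd_Dd[of m n] in \<open>auto simp: g Dd\<close>)
    next
      case (Dh k)
      show thesis
        by (rule that[of "Dh (m + k)" "Dh (m + k)" "- (of_int k + 1/2)" 0])
          (use Dd_Dh[of m k] in \<open>auto simp: g Dh\<close>)
    next
      case Dc
      show thesis by (rule central[of g]) (simp_all add: g Dc Dc_commute[of "Dd m"])
    next
      case Dl
      show thesis by (rule central[of g]) (simp_all add: g Dl Dl_commute[of "Dd m"])
    qed
  next
    case g: (Dh k)
    show thesis
    proof (cases g')
      case (Dd m)
      show thesis
        by (rule that[of "Dh (m + k)" "Dh (m + k)" "of_int k + 1/2" 0])
          (auto simp: g Dd Dd_Dh[of m k] simp flip: scale_left_distrib)
    next
      case (Dh j)
      \<comment> \<open>If \<open>k + j + 1\<close> is nonzero the bracket vanishes;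
        \<open>Dd (k + j + 1)\<close> then occurs with coefficient \<open>0\<close> and only
        supplies the degree \<open>(2 * k + 1) + (2 * j + 1)\<close>.\<close>
      show thesis
        by (rule that[of "if k + j + 1 = 0 then Dl else Dd (k + j + 1)"
              "if k + j + 1 = 0 then Dl else Dd (k + j + 1)"
              "if k + j + 1 = 0 then of_int k + 1/2 else 0" 0])
          (use Dh_Dh[of k j] in \<open>auto simp: g Dh\<close>)
    next
      case Dc
      show thesis by (rule central[of g]) (simp_all add: g Dc Dc_commute[of "Dh k"])
    next
      case Dl
      show thesis by (rule central[of g]) (simp_all add: g Dl Dl_commute[of "Dh k"])
    qed
  next
    case Dc
    show thesis by (rule central[of g']) (simp_all add: Dc Dc_commute[of g'])
  next
    case Dl
    show thesis by (rule central[of g']) (simp_all add: Dl Dl_commute[of g'])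
  qed
qed

section \<open>Eigenvectors, grading and weights\<close>

text \<open>Applying \<open>\<rho> g\<close> minus the scalar \<open>\<mu> i\<close> to the sum
  removes the summand at \<open>i\<close> and multiplies the others by nonzero scalars, so the
  induction hypothesis applies to the rescaled family \<open>f'\<close>.\<close>

lemma eigenvectors_sum_zero:
  assumes "finite J" "inj_on \<mu> J"
    and "\<And>j. j \<in> J \<Longrightarrow> \<rho> g (f j) = sc (\<mu> j) (f j)" and "sum f J = 0"
  shows "\<forall>j\<in>J. f j = 0"
  using assms
proof (induction J arbitrary: f rule: finite_induct)
  case (insert i J)
  define f' where "f' j = sc (\<mu> j - \<mu> i) (f j)" for j
  have "(\<Sum>j\<in>insert i J. f' j) = \<rho> g (sum f (insert i J)) - sc (\<mu> i) (sum f (insert i J))"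
    unfolding act_sum f'_def scale_left_diff_distrib scale_sum_right sum_subtractf
    using sum.cong[OF refl insert.prems(2), of "insert i J" id] by simp
  then have "(\<Sum>j\<in>insert i J. f' j) = 0" using insert.prems(3) by simp
  moreover have "f' i = 0" by (simp add: f'_def)
  ultimately have "sum f' J = 0" using insert by simp
  then have "\<forall>j\<in>J. f' j = 0"
    by (intro insert.IH) (use insert.prems in \<open>auto simp: f'_def mult.commute\<close>)
  moreover have "\<mu> j \<noteq> \<mu> i" if "j \<in> J" for j
    using insert.prems(1) insert.hyps(2) that by (auto simp: inj_on_def)
  ultimately have "\<forall>j\<in>J. f j = 0" by (auto simp: f'_def)
  moreover from this have "f i = 0" using insert by simp
  ultimately show ?case by simp
qed simp

text \<open>\<open>graded v j\<close> is the component of degree \<open>j\<close> of the span of the words in the generators of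
  negative degree, applied to \<open>v\<close>; it is zero for \<open>j > 0\<close>. For a highest weight vector \<open>v\<close> the
  commutation relations make these components stable under all of \<open>D\<close>.\<close>

inductive graded :: "'a \<Rightarrow> int \<Rightarrow> 'a \<Rightarrow> bool" for v where
  zero: "graded v j 0"
| base: "graded v 0 v"
| add: "graded v j x \<Longrightarrow> graded v j y \<Longrightarrow> graded v j (x + y)"
| scale: "graded v j x \<Longrightarrow> graded v j (sc a x)"
| lower: "ddeg g < 0 \<Longrightarrow> graded v j x \<Longrightarrow> graded v (j + ddeg g) (\<rho> g x)"

text \<open>For a highest weight vector \<open>v\<close> this is the whole submodule generated by
  \<open>v\<close>: it is stable under the action by \<open>generated_submodule\<close>.\<close>

inductive generated :: "'a \<Rightarrow> 'a \<Rightarrow> bool" for v where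
  graded: "graded v j x \<Longrightarrow> generated v x"
| add: "generated v x \<Longrightarrow> generated v y \<Longrightarrow> generated v (x + y)"

text \<open>A generator is moved to the right through the lowering word, one letter at a time. The
  commutator terms act on the shorter word, where the induction hypothesis is available for every
  generator. On \<open>v\<close> itself, generators of positive degree give \<open>0\<close> and
  those of degree zero give a multiple of \<open>v\<close>.\<close>

lemma graded_act:
  assumes hw: "hw_vector sc \<rho> c h l v" and "graded v j x"
  shows "graded v (j + ddeg g) (\<rho> g x)"
  using assms(2)
proof (induction arbitrary: g rule: graded.induct)
  case base
  show ?case
  proof (cases "ddeg g < 0")
    case True
    then show ?thesis using graded.lower[OF True graded.base] by simp
  next
    case False
    show ?thesis
    proof (cases g)
      case (Dd m)
      then show ?thesis using hw False graded.scale[OF graded.base, of v h]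
        by (cases "m = 0") (auto simp: hw_vector_def intro: graded.zero)
    next
      case (Dh k)
      then show ?thesis using hw False by (auto simp: hw_vector_def intro: graded.zero)
    qed (use hw graded.scale[OF graded.base] in \<open>auto simp: hw_vector_def\<close>)
  qed
next
  case (lower g' j x)
  obtain a b g1 g2 where d: "ddeg g1 = ddeg g + ddeg g'" "ddeg g2 = ddeg g + ddeg g'"
    and eq: "\<And>x. \<rho> g (\<rho> g' x) = \<rho> g' (\<rho> g x) + sc a (\<rho> g1 x) + sc b (\<rho> g2 x)"
    using commutator[of g g'] by metis
  have "graded v (j + ddeg g + ddeg g') (\<rho> g' (\<rho> g x))"
    by (rule graded.lower[OF lower.hyps(1) lower.IH])
  moreover have "graded v (j + ddeg g + ddeg g') (\<rho> g1 x)"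
    "graded v (j + ddeg g + ddeg g') (\<rho> g2 x)"
    using lower.IH[of g1] lower.IH[of g2] by (simp_all add: d add.assoc)
  ultimately show ?case unfolding eq by (auto simp: add_ac intro!: graded.add graded.scale)
qed (auto intro: graded.zero graded.add graded.scale)

text \<open>Lowering strictly decreases the degree. A lowered vector of degree at least
  \<open>0\<close> therefore comes from a vector of positive degree, which is \<open>0\<close>, and
  in degree \<open>0\<close> only multiples of \<open>v\<close> are left.\<close>

lemma graded_nonneg:
  assumes "graded v j x"
  shows "(0 < j \<longrightarrow> x = 0) \<and> (j = 0 \<longrightarrow> (\<exists>a. x = sc a v))"
  using assms
proof (induction rule: graded.induct)
  case (zero j)
  then show ?case by (auto intro: exI[of _ 0])
next
  case base
  then show ?case by (auto intro: exI[of _ 1])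
next
  case (add j x y)
  then show ?case by (auto simp flip: scale_left_distrib)
next
  case (scale j x a)
  then show ?case by auto
next
  case (lower g j x)
  then show ?case by (auto intro: exI[of _ 0])
qed

text \<open>Since \<open>[d_0, g]\<close> is \<open>- ddeg g / 2\<close> times \<open>g\<close>,
  each letter shifts the \<open>d_0\<close>-eigenvalue by minus half its degree.\<close>

lemma graded_weight:
  assumes hw: "hw_vector sc \<rho> c h l v" and "graded v j x"
  shows "\<rho> (Dd 0) x = sc (h - of_int j / 2) x"
  using assms(2)
proof (induction rule: graded.induct)
  case base
  then show ?case using hw by (simp add: hw_vector_def)
next
  case (lower g j x)
  show ?case
  proof (cases g)
    case (Dd m)
    then show ?thesis using lower Dd_Dd[of 0 m x]
      by (auto simp: scale_minus_left[symmetric] simp flip: scale_left_distrib scale_minus_left)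
        (auto simp: algebra_simps add_divide_distrib)
  next
    case (Dh k)
    have "\<rho> (Dd 0) (\<rho> (Dh k) x) = sc ((h - of_int j / 2) + - (of_int k + 1/2)) (\<rho> (Dh k) x)"
      unfolding Dd_Dh scale_left_distrib lower.IH by simp
    also have "(h - of_int j / 2) + - (of_int k + 1/2) = h - of_int (j + ddeg g) / 2"
      by (simp add: Dh field_simps)
    finally show ?thesis by (simp add: Dh)
  qed (use lower in auto)
qed (auto simp: scale_right_distrib mult.commute)

lemma generated_submodule:
  assumes "hw_vector sc \<rho> c h l v"
  shows "submodule sc \<rho> {x. generated v x}"
proof -
  have "generated v (sc a x)" if "generated v x" for a x
    using that by induction (auto simp: scale_right_distrib intro: generated.intros graded.scale)
  moreover have "generated v (\<rho> g x)" if "generated v x" for g x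
    using that by induction (auto intro: generated.intros graded_act[OF assms])
  ultimately show ?thesis
    unfolding submodule_def by (auto intro: generated.intros graded.zero)
qed

lemma generated_base: "generated v v"
  by (rule generated.graded[OF graded.base])

text \<open>The family \<open>f\<close> is total and vanishes off \<open>J\<close>, so that two
  decompositions can be added over the union of their index sets.\<close>

lemma generated_decomp:
  assumes "generated v x"
  obtains J f where "finite J" "\<And>j. graded v j (f j)" "\<And>j. j \<notin> J \<Longrightarrow> f j = 0" "x = sum f J"
proof -
  have "\<exists>J f. finite J \<and> (\<forall>j. graded v j (f j)) \<and> (\<forall>j. j \<notin> J \<longrightarrow> f j = 0) \<and> x = sum f J"
    using assms
  proof induction
    case (graded j x)
    then show ?case
      by (intro exI[of _ "{j}"] exI[of _ "\<lambda>i. if i = j then x else 0"]) (auto intro: graded.zero)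
  next
    case (add x y)
    then obtain J f J' f' where *: "finite J" "\<forall>j. graded v j (f j)" "\<forall>j. j \<notin> J \<longrightarrow> f j = 0"
       "x = sum f J" "finite J'" "\<forall>j. graded v j (f' j)" "\<forall>j. j \<notin> J' \<longrightarrow> f' j = 0" "y = sum f' J'"
      by metis
    have "x = sum f (J \<union> J')" "y = sum f' (J \<union> J')"
      using * by (auto intro!: sum.mono_neutral_left)
    then show ?case using *
      by (intro exI[of _ "J \<union> J'"] exI[of _ "\<lambda>j. f j + f' j"])
        (auto simp: sum.distrib intro: graded.add)
  qed
  then show thesis using that by metis
qed

text \<open>Homogeneous components of different degree have different \<open>d_0\<close>-weights, so
  an eigenvector of \<open>d_0\<close> has exactly one nonzero component.\<close>

lemma generated_eigenvector:
  assumes hw: "hw_vector sc \<rho> c h l v" and "generated v x"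
    and x: "\<rho> (Dd 0) x = sc \<mu> x" "x \<noteq> 0"
  obtains j where "graded v j x" "\<mu> = h - of_int j / 2"
proof -
  obtain J f where J: "finite J" "\<And>j. graded v j (f j)" "\<And>j. j \<notin> J \<Longrightarrow> f j = 0" "x = sum f J"
    using generated_decomp[OF assms(2)] by metis
  define wt where "wt j = h - of_int j / 2" for j :: int
  \<comment> \<open>These are the components of \<open>\<rho> (Dd 0) x - sc \<mu> x\<close>, which
    is \<open>0\<close>.\<close>
  define f' where "f' j = sc (wt j - \<mu>) (f j)" for j
  have weight: "\<rho> (Dd 0) (f j) = sc (wt j) (f j)" for j
    unfolding wt_def by (rule graded_weight[OF hw J(2)])
  have "sum f' J = \<rho> (Dd 0) x - sc \<mu> x"
    by (simp add: J act_sum f'_def scale_left_diff_distrib weight sum_subtractf scale_sum_right)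
  then have "sum f' J = 0" using x by simp
  then have "\<forall>j\<in>J. f' j = 0"
    by (intro eigenvectors_sum_zero[OF J(1), of wt "Dd 0"])
      (auto simp: f'_def weight mult.commute inj_on_def wt_def)
  then have *: "f j = 0 \<or> wt j = \<mu>" for j using J(3)[of j] by (cases "j \<in> J") (auto simp: f'_def)
  obtain j where j: "j \<in> J" "f j \<noteq> 0" using x J(4) by (metis sum.neutral)
  have "f i = 0" if "i \<noteq> j" for i using *[of i] *[of j] j that by (auto simp: wt_def)
  then have "sum f J = f j" using J(1) j(1) by (subst sum.remove[of _ j]) auto
  then show thesis using that[of j] *[of j] j J(2)[of j] J(4) by (auto simp: wt_def)
qed

section \<open>Submodules and irreducibility\<close>

text \<open>In an irreducible module this submodule is everything once it contains a nonzero vector.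
  This is why generators of large degree act on a fixed tensor through the second factor
  only.\<close>

lemma locally_nilpotent_submodule:
  "submodule sc \<rho> {x. \<exists>N. \<forall>g. N \<le> ddeg g \<longrightarrow> \<rho> g x = 0}" (is "submodule _ _ ?W")
proof -
  have "x + y \<in> ?W" if xy: "x \<in> ?W" "y \<in> ?W" for x y
  proof -
    obtain N M where "\<forall>g. N \<le> ddeg g \<longrightarrow> \<rho> g x = 0" "\<forall>g. M \<le> ddeg g \<longrightarrow> \<rho> g y = 0"
      using xy by blast
    then show ?thesis by (auto intro!: exI[of _ "max N M"])
  qed
  moreover have "\<rho> g x \<in> ?W" if x: "x \<in> ?W" for g x
  proof -
    obtain N where N: "\<forall>g. N \<le> ddeg g \<longrightarrow> \<rho> g x = 0" using x by blast
    \<comment> \<open>With the bound enlarged by the absolute value of \<open>ddeg g\<close>, both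
      \<open>g'\<close> and the commutator terms of degree \<open>ddeg g' + ddeg g\<close> still
      have degree at least \<open>N\<close>.\<close>
    have "\<rho> g' (\<rho> g x) = 0" if g': "N + \<bar>ddeg g\<bar> \<le> ddeg g'" for g'
    proof -
      obtain a b g1 g2 where "ddeg g1 = ddeg g' + ddeg g" "ddeg g2 = ddeg g' + ddeg g"
        "\<And>x. \<rho> g' (\<rho> g x) = \<rho> g (\<rho> g' x) + sc a (\<rho> g1 x) + sc b (\<rho> g2 x)"
        using commutator[of g' g] by metis
      then show ?thesis using g' N by simp
    qed
    then show ?thesis by blast
  qed
  ultimately show ?thesis by (auto simp: submodule_def)
qed

text \<open>Takes the place of Schur's lemma: in an irreducible module a nonzero eigenspace of a
  central element is everything, so \<open>c\<close> and \<open>l\<close> act by scalars.\<close>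

lemma central_submodule:
  "submodule sc \<rho> {x. \<rho> Dc x = sc c x}" "submodule sc \<rho> {x. \<rho> Dl x = sc l x}"
  unfolding submodule_def using Dc_commute Dl_commute
  by (simp_all add: scale_right_distrib mult.commute)

end

locale D_irreducible = D_mod +
  assumes irreducible: "irreducible_D sc \<rho>"
begin

lemma submodule_UNIV:
  assumes "submodule sc \<rho> W" "x \<in> W" "x \<noteq> 0"
  shows "y \<in> W"
  using irreducible assms unfolding irreducible_D_def by blast

lemma hw_generated:
  assumes "hw_vector sc \<rho> c h l v"
  shows "generated v x"
  using submodule_UNIV[OF generated_submodule[OF assms], of v x] generated_base assms
  by (simp add: hw_vector_def)

lemma hw_nilpotent:
  assumes "hw_vector sc \<rho> c h l v"
  obtains N where "\<And>g. N \<le> ddeg g \<Longrightarrow> \<rho> g x = 0"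
proof -
  have "\<rho> g v = 0" if "1 \<le> ddeg g" for g
    using assms that by (cases g) (auto simp: hw_vector_def)
  then show thesis
    using submodule_UNIV[OF locally_nilpotent_submodule, of v x] assms that
    by (auto simp: hw_vector_def)
qed

text \<open>The central charges are the scalars by which \<open>c\<close> and \<open>l\<close> act.
  For \<open>h\<close>, each of the two vectors is homogeneous of degree at most \<open>0\<close>
  with respect to the other; the two degrees sum to \<open>0\<close>, so both vanish.\<close>

lemma hw_unique:
  assumes hw: "hw_vector sc \<rho> c h l v" and hw': "hw_vector sc \<rho> c' h' l' v'"
  shows "(c, h, l) = (c', h', l')"
proof -
  have nz: "v \<noteq> 0" "v' \<noteq> 0" using hw hw' by (auto simp: hw_vector_def)
  have "\<rho> Dc v' = sc c v'"
    using submodule_UNIV[OF central_submodule(1)[of c], of v v'] hw nz by (simp add: hw_vector_def)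
  then have c: "c = c'" using hw' nz by (simp add: hw_vector_def)
  have "\<rho> Dl v' = sc l v'"
    using submodule_UNIV[OF central_submodule(2)[of l], of v v'] hw nz by (simp add: hw_vector_def)
  then have l: "l = l'" using hw' nz by (simp add: hw_vector_def)
  obtain i where i: "graded v i v'" "h' = h - of_int i / 2"
    using generated_eigenvector[OF hw hw_generated[OF hw], of v' h'] hw' nz
    by (auto simp: hw_vector_def)
  obtain j where j: "graded v' j v" "h = h' - of_int j / 2"
    using generated_eigenvector[OF hw' hw_generated[OF hw'], of v h] hw nz
    by (auto simp: hw_vector_def)
  have "i \<le> 0" "j \<le> 0" using graded_nonneg[OF i(1)] graded_nonneg[OF j(1)] nz by force+
  moreover have "of_int i / 2 + of_int j / 2 = (0 :: complex)" using i(2) j(2)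
    by (metis add_diff_cancel_left' diff_add_cancel add.commute diff_diff_add diff_self)
  then have "of_int (i + j) = (0 :: complex)" by (simp add: add_divide_distrib[symmetric])
  then have "i + j = 0" by (simp only: of_int_eq_0_iff)
  ultimately have "i = 0" by simp
  then show ?thesis using c l i(2) by simp
qed

end

lemma is_L_irreducible: "is_L sc \<rho> c h l \<Longrightarrow> D_irreducible sc \<rho>"
  by (simp add: is_L_def irreducible_D_def D_irreducible_def D_mod_def D_module_def
      D_mod_axioms_def D_irreducible_axioms_def)

section \<open>Uniqueness of the irreducible highest weight module\<close>

lemma D_module_prod:
  assumes "D_module sc \<rho>" "D_module sc1 \<rho>1"
  shows "D_module (\<lambda>a (x, y). (sc a x, sc1 a y)) (\<lambda>g (x, y). (\<rho> g x, \<rho>1 g y))"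
proof -
  interpret M: D_mod sc \<rho> using assms by (simp add: D_mod_def D_mod_axioms_def D_module_def)
  interpret N: D_mod sc1 \<rho>1 using assms by (simp add: D_mod_def D_mod_axioms_def D_module_def)
  have "vector_space (\<lambda>a (x, y). (sc a x, sc1 a y))"
    by unfold_locales (auto simp: M.scale_right_distrib N.scale_right_distrib
       M.scale_left_distrib N.scale_left_distrib)
  then show ?thesis
    unfolding D_module_def lin_op_def
    by (intro conjI allI)
      (simp_all add: split_beta M.bracket_Dd_Dd N.bracket_Dd_Dd M.bracket_Dd_Dh N.bracket_Dd_Dh M.bracket_Dh_Dh N.bracket_Dh_Dh zero_prod_def,
       (rule M.Dc_commute N.Dc_commute M.Dl_commute N.Dl_commute conjI)+)
qed

text \<open>The submodule of the direct sum generated by the pair of highest weight vectors is the graph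
  of an isomorphism: its kernels are submodules of irreducible modules, and they are proper because
  the part of top weight is spanned by that pair.\<close>

lemma is_L_unique:
  assumes L: "is_L sc \<rho> c h l" and L1: "is_L sc1 \<rho>1 c h l"
  shows "mod_iso UNIV sc \<rho> UNIV sc1 \<rho>1"
proof -
  interpret L: D_irreducible sc \<rho> by (rule is_L_irreducible[OF L])
  interpret L1: D_irreducible sc1 \<rho>1 by (rule is_L_irreducible[OF L1])
  define scp where "scp = (\<lambda>a (x, y). (sc a x, sc1 a y))"
  define rp where "rp = (\<lambda>g (x, y). (\<rho> g x, \<rho>1 g y))"
  interpret P: D_mod scp rp
    using D_module_prod[OF L.D_module L1.D_module]
    by (simp add: D_mod_def D_mod_axioms_def scp_def rp_def D_module_def)
  obtain v where v: "hw_vector sc \<rho> c h l v" using L by (auto simp: is_L_def)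
  obtain v1 where v1: "hw_vector sc1 \<rho>1 c h l v1" using L1 by (auto simp: is_L_def)
  have nz: "v \<noteq> 0" "v1 \<noteq> 0" using v v1 by (auto simp: hw_vector_def)
  have hw: "hw_vector scp rp c h l (v, v1)"
    using v v1 by (auto simp: hw_vector_def scp_def rp_def zero_prod_def)
  define R where "R x y \<longleftrightarrow> P.generated (v, v1) (x, y)" for x y
  have sub: "submodule scp rp {p. P.generated (v, v1) p}" by (rule P.generated_submodule[OF hw])
  have R_zero: "R 0 0"
    using sub by (auto simp: R_def submodule_def zero_prod_def)
  have R_add: "R (x + x') (y + y')" if "R x y" "R x' y'" for x x' y y'
    using sub that by (auto simp: R_def submodule_def simp flip: add_Pair)
  have R_scale: "R (sc a x) (sc1 a y)" if "R x y" for a x y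
    using sub that by (force simp: R_def submodule_def scp_def)
  have R_act: "R (\<rho> g x) (\<rho>1 g y)" if "R x y" for g x y
    using sub that by (force simp: R_def submodule_def rp_def)
  have R_base: "R v v1" unfolding R_def by (rule P.generated_base)
  \<comment> \<open>Both \<open>(v, 0)\<close> and \<open>(0, v1)\<close> have weight
    \<open>h\<close>, hence would lie in degree \<open>0\<close> of the module generated by
    \<open>(v, v1)\<close>, but neither is a multiple of \<open>(v, v1)\<close>.\<close>
  have no_split: "\<not> R v 0" "\<not> R 0 v1"
  proof -
    have weight_h: "\<exists>a. p = scp a (v, v1)"
      if p: "P.generated (v, v1) p" "rp (Dd 0) p = scp h p" "p \<noteq> 0" for p
    proof -
      obtain j where "P.graded (v, v1) j p" "h = h - of_int j / 2"
        using P.generated_eigenvector[OF hw p] .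
      then show ?thesis using P.graded_nonneg[of "(v, v1)" j p] by simp
    qed
    show "\<not> R v 0"
      using weight_h[of "(v, 0)"] nz v
      by (auto simp: R_def hw_vector_def scp_def rp_def zero_prod_def)
    show "\<not> R 0 v1"
      using weight_h[of "(0, v1)"] nz v1
      by (auto simp: R_def hw_vector_def scp_def rp_def zero_prod_def)
  qed
  \<comment> \<open>The projections of \<open>R\<close> to the two factors are nonzero submodules,
    hence everything.\<close>
  have total: "\<exists>y. R x y" for x
  proof -
    have "submodule sc \<rho> {x. \<exists>y. R x y}"
      unfolding submodule_def using R_zero R_add R_scale R_act by blast
    from L.submodule_UNIV[OF this, of v x] show ?thesis using R_base nz by blast
  qed
  have surj: "\<exists>x. R x y" for y
  proof -
    have "submodule sc1 \<rho>1 {y. \<exists>x. R x y}"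
      unfolding submodule_def using R_zero R_add R_scale R_act by blast
    from L1.submodule_UNIV[OF this, of v1 y] show ?thesis using R_base nz by blast
  qed
  have R_diff: "R (x - x') (y - y')" if "R x y" "R x' y'" for x x' y y'
    using R_add[OF that(1) R_scale[OF that(2), of "-1"]] by simp
  have unique: "y = y'" if "R x y" "R x y'" for x y y'
  proof (rule ccontr)
    have "submodule sc1 \<rho>1 {y. R 0 y}"
      unfolding submodule_def
      using R_zero R_add[of 0 _ 0] R_scale[of 0] R_act[of 0] by force
    moreover assume "y \<noteq> y'"
    moreover have "R 0 (y - y')" using R_diff[OF that] by simp
    ultimately have "R 0 v1" using L1.submodule_UNIV[of "{y. R 0 y}" "y - y'" v1] by simp
    then show False using no_split by blast
  qed
  have inj: "x = x'" if "R x y" "R x' y" for x x' y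
  proof (rule ccontr)
    have "submodule sc \<rho> {x. R x 0}"
      unfolding submodule_def
      using R_zero R_add[of _ 0 _ 0] R_scale[of _ 0] R_act[of _ 0] by force
    moreover assume "x \<noteq> x'"
    moreover have "R (x - x') 0" using R_diff[OF that] by simp
    ultimately have "R v 0" using L.submodule_UNIV[of "{x. R x 0}" "x - x'" v] by simp
    then show False using no_split by blast
  qed
  obtain \<psi> where \<psi>: "\<And>x. R x (\<psi> x)" using total by metis
  then have eq: "R x y \<longleftrightarrow> y = \<psi> x" for x y using unique by blast
  have "bij \<psi>" unfolding bij_def inj_def surj_def using \<psi> inj surj eq by metis
  moreover have "\<psi> (x + y) = \<psi> x + \<psi> y" for x y using R_add[OF \<psi>[of x] \<psi>[of y]] eq by simp
  moreover have "\<psi> (sc a x) = sc1 a (\<psi> x)" for a x using R_scale[OF \<psi>[of x]] eq by simp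
  moreover have "\<psi> (\<rho> g x) = \<rho>1 g (\<psi> x)" for g x using R_act[OF \<psi>[of x]] eq by simp
  ultimately show ?thesis unfolding mod_iso_def by blast
qed

section \<open>Isomorphisms between the tensor products\<close>

definition supp_on :: "int set \<Rightarrow> (int \<Rightarrow> 'a::zero) set" where
  "supp_on I = {f. finite {i. f i \<noteq> 0} \<and> {i. f i \<noteq> 0} \<subseteq> I}"

lemma tensA_carrier_supp_on: "tensA_carrier = supp_on UNIV"
  and tensA'_carrier_supp_on: "tensA'_carrier \<alpha> \<beta> = supp_on (Aprime_index \<alpha> \<beta>)"
  by (simp_all add: tensA_carrier_def tensA'_carrier_def supp_on_def)

text \<open>The tensor product of \<open>\<psi>\<close> with a shift and rescaling of the basis:
  \<open>x\<close> at index \<open>k\<close> goes to \<open>c (k - n)\<close> times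
  \<open>\<psi> x\<close> at index \<open>k - n\<close>.\<close>

definition twist ::
  "(complex \<Rightarrow> 'b \<Rightarrow> 'b) \<Rightarrow> (int \<Rightarrow> complex) \<Rightarrow> int \<Rightarrow> ('a \<Rightarrow> 'b) \<Rightarrow> (int \<Rightarrow> 'a) \<Rightarrow> int \<Rightarrow> 'b" where
  "twist sc c n \<psi> f = (\<lambda>i. sc (c i) (\<psi> (f (i + n))))"

text \<open>Bijectivity and linearity come from \<open>\<psi>\<close> and the nonzero scalars, so
  each family of modules only has to supply the intertwining relation. That relation is asked on
  \<open>supp_on I\<close> alone, which lets the removed index of \<open>A'\<close> be
  ignored.\<close>

lemma mod_iso_twist:
  fixes sc :: "complex \<Rightarrow> 'a::ab_group_add \<Rightarrow> 'a" and sc1 :: "complex \<Rightarrow> 'b::ab_group_add \<Rightarrow> 'b"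
  assumes V1: "vector_space sc1"
    and iso: "mod_iso UNIV sc \<rho> UNIV sc1 \<rho>1"
    and c: "\<And>i. c i \<noteq> 0" and J: "\<And>i. i \<in> J \<longleftrightarrow> i + n \<in> I"
    and twist: "\<And>\<psi> g f. \<lbrakk>\<And>x y. \<psi> (x + y) = \<psi> x + \<psi> y; \<And>a x. \<psi> (sc a x) = sc1 a (\<psi> x);
         \<And>g x. \<psi> (\<rho> g x) = \<rho>1 g (\<psi> x); \<psi> 0 = 0; f \<in> supp_on I\<rbrakk>
         \<Longrightarrow> twist sc1 c n \<psi> (act g f) = act1 g (twist sc1 c n \<psi> f)"
  shows "mod_iso (supp_on I) (fsc sc) act (supp_on J) (fsc sc1) act1"
proof -
  interpret V1: vector_space sc1 by (rule V1)
  obtain \<psi> where bij: "bij \<psi>" and \<psi>: "\<And>x y. \<psi> (x + y) = \<psi> x + \<psi> y"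
      "\<And>a x. \<psi> (sc a x) = sc1 a (\<psi> x)" "\<And>g x. \<psi> (\<rho> g x) = \<rho>1 g (\<psi> x)"
    using iso unfolding mod_iso_def by blast
  have \<psi>0: "\<psi> 0 = 0" using \<psi>(1)[of 0 0] by simp
  have \<psi>_eq0: "\<psi> x = 0 \<longleftrightarrow> x = 0" for x
    using \<psi>0 bij_is_inj[OF bij] by (metis injD)
  have supp: "twist sc1 c n \<psi> f i \<noteq> 0 \<longleftrightarrow> f (i + n) \<noteq> 0" for f i
    using c[of i] by (simp add: twist_def \<psi>_eq0)
  have fin: "finite {i. f (i + m) \<noteq> 0} \<longleftrightarrow> finite {i. f i \<noteq> 0}" for f :: "int \<Rightarrow> 'c::zero" and m
  proof -
    have "bij_betw (\<lambda>i. i + m) {i. f (i + m) \<noteq> 0} {i. f i \<noteq> 0}"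
      by (rule bij_betw_byWitness[of _ "\<lambda>i. i - m"]) auto
    then show ?thesis by (rule bij_betw_finite)
  qed
  have mem: "twist sc1 c n \<psi> f \<in> supp_on J \<longleftrightarrow> f \<in> supp_on I" for f
  proof -
    have "(\<forall>i. f (i + n) \<noteq> 0 \<longrightarrow> i + n \<in> I) \<longleftrightarrow> (\<forall>i. f i \<noteq> 0 \<longrightarrow> i \<in> I)"
      by (metis diff_add_cancel)
    then show ?thesis
      using fin[of f n] by (auto simp: supp_on_def supp J subset_iff)
  qed
  have inj: "inj (twist sc1 c n \<psi>)"
  proof (rule injI, rule ext)
    fix f g i assume "twist sc1 c n \<psi> f = twist sc1 c n \<psi> g"
    then have "twist sc1 c n \<psi> f (i - n) = twist sc1 c n \<psi> g (i - n)" by simp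
    then show "f i = g i" using c bij_is_inj[OF bij] by (simp add: twist_def inj_eq)
  qed
  have surj: "\<exists>f. g = twist sc1 c n \<psi> f" for g
  proof
    show "g = twist sc1 c n \<psi> (\<lambda>i. inv \<psi> (sc1 (1 / c (i - n)) (g (i - n))))"
      using c by (simp add: twist_def surj_f_inv_f[OF bij_is_surj[OF bij]])
  qed
  have "bij_betw (twist sc1 c n \<psi>) (supp_on I) (supp_on J)"
    unfolding bij_betw_def using inj surj mem by (fastforce intro: inj_on_subset)
  moreover have "twist sc1 c n \<psi> (f + g) = twist sc1 c n \<psi> f + twist sc1 c n \<psi> g" for f g
    by (auto simp: twist_def \<psi> V1.scale_right_distrib)
  moreover have "twist sc1 c n \<psi> (fsc sc a f) = fsc sc1 a (twist sc1 c n \<psi> f)" for a f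
    by (auto simp: twist_def fsc_def \<psi> mult.commute)
  ultimately show ?thesis
    unfolding mod_iso_def using twist[OF \<psi> \<psi>0]
    by (intro exI[of _ "twist sc1 c n \<psi>"]) blast
qed

lemma is_L_vector_space: "is_L sc \<rho> c h l \<Longrightarrow> vector_space sc"
  by (simp add: is_L_def irreducible_D_def D_module_def)

lemma tensA_iso:
  fixes sc :: "complex \<Rightarrow> 'a::ab_group_add \<Rightarrow> 'a" and sc1 :: "complex \<Rightarrow> 'b::ab_group_add \<Rightarrow> 'b"
  assumes L: "is_L sc \<rho> c h l" and L1: "is_L sc1 \<rho>1 c h l" and \<gamma>: "\<gamma> \<noteq> 0"
    and \<alpha>: "2 * (\<alpha> - \<alpha>1) \<in> \<int>"
  shows "mod_iso tensA_carrier (fsc sc) (tensA_act sc \<rho> \<alpha> \<beta> \<gamma>)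
    tensA_carrier (fsc sc1) (tensA_act sc1 \<rho>1 \<alpha>1 \<beta> \<gamma>)"
proof -
  interpret L1: D_irreducible sc1 \<rho>1 by (rule is_L_irreducible[OF L1])
  obtain n where n: "2 * (\<alpha> - \<alpha>1) = of_int n" using \<alpha> by (auto elim: Ints_cases)
  then have \<alpha>_eq: "\<alpha> = \<alpha>1 + of_int n / 2" by (simp add: field_simps)
  \<comment> \<open>A shift by an odd index exchanges the two parities, on which \<open>h\<^sub>r\<close> acts by \<open>1\<close> and \<open>\<gamma>\<close>.\<close>
  define c' where "c' i = (if odd n \<and> even i then \<gamma> else 1)" for i :: int
  show ?thesis unfolding tensA_carrier_supp_on
  proof (rule mod_iso_twist[where c = c' and n = n])
    show "vector_space sc1" by (rule is_L_vector_space[OF L1])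
    show "mod_iso UNIV sc \<rho> UNIV sc1 \<rho>1" by (rule is_L_unique[OF L L1])
    show "c' i \<noteq> 0" for i using \<gamma> by (simp add: c'_def)
    fix \<psi> g and f :: "int \<Rightarrow> 'a"
    assume \<psi>: "\<And>x y. \<psi> (x + y) = \<psi> x + \<psi> y" "\<And>a x. \<psi> (sc a x) = sc1 a (\<psi> x)"
      "\<And>g x. \<psi> (\<rho> g x) = \<rho>1 g (\<psi> x)"
    have shift: "i + n - m = i - m + n" for i m by simp
    show "twist sc1 c' n \<psi> (tensA_act sc \<rho> \<alpha> \<beta> \<gamma> g f) = tensA_act sc1 \<rho>1 \<alpha>1 \<beta> \<gamma> g (twist sc1 c' n \<psi> f)"
    proof
      fix i
      show "twist sc1 c' n \<psi> (tensA_act sc \<rho> \<alpha> \<beta> \<gamma> g f) i = tensA_act sc1 \<rho>1 \<alpha>1 \<beta> \<gamma> g (twist sc1 c' n \<psi> f) i"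
      proof (cases g)
        case (Dd m)
        have "c' i * (\<alpha> + \<beta> * of_int m - of_int (i - 2 * m + n) / 2)
          = c' (i - 2 * m) * (\<alpha>1 + \<beta> * of_int m - of_int (i - 2 * m) / 2)"
          by (simp add: c'_def \<alpha>_eq field_simps)
        then show ?thesis
          by (simp only: twist_def tensA_act_def Dd shift \<psi> Dgen.case
              L1.act_scale L1.scale_right_distrib L1.scale_scale mult.commute[of _ "c' _"])
      next
        case (Dh k)
        define q where "q = 2 * k + 1"
        have "c' i * (if even (i - q + n) then 1 else \<gamma>) = c' (i - q) * (if even (i - q) then 1 else \<gamma>)"
          by (auto simp: c'_def q_def)
        then show ?thesis
          by (simp only: twist_def tensA_act_def Dh shift \<psi> Dgen.case
              L1.act_scale L1.scale_right_distrib L1.scale_scale mult.commute[of _ "c' _"]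
              q_def[symmetric])
      qed (simp_all add: twist_def tensA_act_def \<psi>)
    qed
  qed simp
qed

lemma tensA'_iso:
  fixes sc :: "complex \<Rightarrow> 'a::ab_group_add \<Rightarrow> 'a" and sc1 :: "complex \<Rightarrow> 'b::ab_group_add \<Rightarrow> 'b"
  assumes L: "is_L sc \<rho> c h l" and L1: "is_L sc1 \<rho>1 c h l"
    and \<alpha>: "\<alpha> - \<alpha>1 \<in> \<int>" and \<beta>: "\<beta> = \<beta>1 \<or> {\<beta>, \<beta>1} = {0, -1}"
  shows "mod_iso (tensA'_carrier \<alpha> \<beta>) (fsc sc) (tensA'_act sc \<rho> \<alpha> \<beta>)
    (tensA'_carrier \<alpha>1 \<beta>1) (fsc sc1) (tensA'_act sc1 \<rho>1 \<alpha>1 \<beta>1)"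
proof -
  interpret L1: D_irreducible sc1 \<rho>1 by (rule is_L_irreducible[OF L1])
  obtain n where n: "\<alpha> - \<alpha>1 = of_int n" using \<alpha> by (auto elim: Ints_cases)
  then have \<alpha>_eq: "\<alpha> = \<alpha>1 + of_int n" by (simp add: algebra_simps)
  \<comment> \<open>Passing between \<open>\<beta> = 0\<close> and \<open>\<beta> = -1\<close> rescales \<open>v\<^sub>k\<close> by \<open>\<alpha> - k\<close>.\<close>
  define c' where "c' i = (if \<beta> = \<beta>1 \<or> \<alpha>1 = of_int i then 1
     else if \<beta> = 0 then \<alpha>1 - of_int i else 1 / (\<alpha>1 - of_int i))" for i :: int
  have \<beta>_cases: "\<beta> = \<beta>1 \<or> \<beta> = 0 \<and> \<beta>1 = -1 \<or> \<beta> = -1 \<and> \<beta>1 = 0"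
    using \<beta> by (auto simp: doubleton_eq_iff)
  have index: "i \<in> Aprime_index \<alpha>1 \<beta>1 \<longleftrightarrow> i + n \<in> Aprime_index \<alpha> \<beta>" for i
    using \<beta>_cases by (auto simp: Aprime_index_def \<alpha>_eq)
  show ?thesis unfolding tensA'_carrier_supp_on
  proof (rule mod_iso_twist[where c = c' and n = n])
    show "vector_space sc1" by (rule is_L_vector_space[OF L1])
    show "mod_iso UNIV sc \<rho> UNIV sc1 \<rho>1" by (rule is_L_unique[OF L L1])
    \<comment> \<open>When \<open>\<beta>\<close> and \<open>\<beta>1\<close> differ, the factor
      \<open>\<alpha>1 - i\<close> would degenerate at the removed index; the default value
      \<open>1\<close> there keeps all scalars nonzero.\<close>
    show "c' i \<noteq> 0" for i by (simp add: c'_def)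
    show "i \<in> Aprime_index \<alpha>1 \<beta>1 \<longleftrightarrow> i + n \<in> Aprime_index \<alpha> \<beta>" for i by (rule index)
    fix \<psi> g and f :: "int \<Rightarrow> 'a"
    assume \<psi>: "\<And>x y. \<psi> (x + y) = \<psi> x + \<psi> y" "\<And>a x. \<psi> (sc a x) = sc1 a (\<psi> x)"
      "\<And>g x. \<psi> (\<rho> g x) = \<rho>1 g (\<psi> x)" "\<psi> 0 = 0" and f: "f \<in> supp_on (Aprime_index \<alpha> \<beta>)"
    have shift: "i + n - m = i - m + n" for i m by simp
    show "twist sc1 c' n \<psi> (tensA'_act sc \<rho> \<alpha> \<beta> g f) = tensA'_act sc1 \<rho>1 \<alpha>1 \<beta>1 g (twist sc1 c' n \<psi> f)"
    proof
      fix i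
      show "twist sc1 c' n \<psi> (tensA'_act sc \<rho> \<alpha> \<beta> g f) i
        = tensA'_act sc1 \<rho>1 \<alpha>1 \<beta>1 g (twist sc1 c' n \<psi> f) i"
      proof (cases "i \<in> Aprime_index \<alpha>1 \<beta>1")
        case False
        then show ?thesis using index[of i] by (simp add: twist_def tensA'_act_def \<psi>)
      next
        case True
        note i = this
        show ?thesis
        proof (cases g)
          case (Dd m)
          \<comment> \<open>Where \<open>i - m\<close> is a removed index \<open>f\<close> vanishes;
            elsewhere the scalars themselves agree.\<close>
          have "sc1 (c' i * (\<alpha> + \<beta> * of_int m - of_int (i - m + n))) (\<psi> (f (i - m + n)))
            = sc1 (c' (i - m) * (\<alpha>1 + \<beta>1 * of_int m - of_int (i - m))) (\<psi> (f (i - m + n)))"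
          proof (cases "i - m \<in> Aprime_index \<alpha>1 \<beta>1")
            case False
            then have "f (i - m + n) = 0" using f index[of "i - m"] by (auto simp: supp_on_def)
            then show ?thesis by (simp add: \<psi>)
          next
            case True
            then have "c' i * (\<alpha> + \<beta> * of_int m - of_int (i - m + n))
              = c' (i - m) * (\<alpha>1 + \<beta>1 * of_int m - of_int (i - m))"
              using \<beta>_cases
            proof (elim disjE)
              assume "\<beta> = \<beta>1"
              then show ?thesis by (simp add: c'_def \<alpha>_eq)
            next
              assume "\<beta> = 0 \<and> \<beta>1 = -1"
              then show ?thesis using i True by (auto simp: c'_def \<alpha>_eq Aprime_index_def)
            next
              assume \<beta>: "\<beta> = -1 \<and> \<beta>1 = 0"
              then have ne: "\<alpha>1 \<noteq> of_int i" "\<alpha>1 \<noteq> of_int (i - m)"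
                using i True unfolding Aprime_index_def by blast+
              then have nz: "\<alpha>1 - of_int i \<noteq> 0" "\<alpha>1 - of_int (i - m) \<noteq> 0"
                unfolding right_minus_eq by blast+
              have "c' i = 1 / (\<alpha>1 - of_int i)" "c' (i - m) = 1 / (\<alpha>1 - of_int (i - m))"
                using \<beta> ne unfolding c'_def by simp_all
              moreover have "\<alpha> + \<beta> * of_int m - of_int (i - m + n) = \<alpha>1 - of_int i"
                using \<beta> by (simp add: \<alpha>_eq)
              ultimately show ?thesis using \<beta> nz by simp
            qed
            then show ?thesis by simp
          qed
          then show ?thesis using i index[of i]
            by (simp only: twist_def tensA'_act_def Dd shift \<psi> Dgen.case if_True
                L1.act_scale L1.scale_right_distrib L1.scale_scale mult.commute[of _ "c' _"])
        qed (use i index[of i] in \<open>simp_all add: twist_def tensA'_act_def \<psi>\<close>)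
      qed
    qed
  qed
qed

section \<open>Invariants of the tensor products\<close>

definition pure_tensor :: "int \<Rightarrow> 'a \<Rightarrow> int \<Rightarrow> 'a::zero" where
  "pure_tensor k x = (\<lambda>i. if i = k then x else 0)"

lemma pure_tensor_supp_on: "k \<in> I \<Longrightarrow> pure_tensor k x \<in> supp_on I"
  by (auto simp: pure_tensor_def supp_on_def)

lemma mod_isoE:
  fixes sc :: "complex \<Rightarrow> 'a::ab_group_add \<Rightarrow> 'a" and sc1 :: "complex \<Rightarrow> 'b::ab_group_add \<Rightarrow> 'b"
  assumes "mod_iso S sc \<rho> T sc1 \<rho>1" "0 \<in> S"
  obtains \<phi> where "\<And>x. x \<in> S \<Longrightarrow> \<phi> x \<in> T" "\<And>x. x \<in> S \<Longrightarrow> \<phi> x = 0 \<Longrightarrow> x = 0" "\<phi> 0 = 0"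
    "\<And>a x. x \<in> S \<Longrightarrow> \<phi> (sc a x) = sc1 a (\<phi> x)" "\<And>g x. x \<in> S \<Longrightarrow> \<phi> (\<rho> g x) = \<rho>1 g (\<phi> x)"
proof -
  obtain \<phi> where \<phi>: "bij_betw \<phi> S T" "\<And>x y. x \<in> S \<Longrightarrow> y \<in> S \<Longrightarrow> \<phi> (x + y) = \<phi> x + \<phi> y"
    "\<And>a x. x \<in> S \<Longrightarrow> \<phi> (sc a x) = sc1 a (\<phi> x)" "\<And>g x. x \<in> S \<Longrightarrow> \<phi> (\<rho> g x) = \<rho>1 g (\<phi> x)"
    using assms(1) unfolding mod_iso_def by blast
  have "\<phi> 0 = 0" using \<phi>(2)[OF assms(2,2)] by simp
  moreover have "x = 0" if "x \<in> S" "\<phi> x = 0" for x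
    using bij_betw_imp_inj_on[OF \<phi>(1)] that assms(2) \<open>\<phi> 0 = 0\<close> by (metis inj_onD)
  ultimately show thesis using that \<phi> by (metis bij_betwE)
qed

lemma zero_supp_on: "0 \<in> supp_on I"
  by (simp add: supp_on_def)

text \<open>Finite support allows one bound for all components. Taking it at least \<open>1\<close>
  makes the generators chosen beyond it positive, so that they kill the highest weight vector
  too.\<close>

lemma (in D_irreducible) hw_nilpotent_family:
  assumes hw: "hw_vector sc \<rho> c h l v" and f: "f \<in> supp_on I"
  obtains N where "1 \<le> N" "\<And>g i. N \<le> ddeg g \<Longrightarrow> \<rho> g (f i) = 0"
proof -
  have fin: "finite {i. f i \<noteq> 0}" using f by (simp add: supp_on_def)
  have "\<exists>N. \<forall>g. N \<le> ddeg g \<longrightarrow> \<rho> g (f i) = 0" for i using hw_nilpotent[OF hw] by metis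
  then obtain N where N: "\<And>i g. N i \<le> ddeg g \<Longrightarrow> \<rho> g (f i) = 0" by metis
  define M where "M = Max (insert 1 (N ` {i. f i \<noteq> 0}))"
  have "\<rho> g (f i) = 0" if "M \<le> ddeg g" for g i
  proof (cases "f i = 0")
    case False
    then have "N i \<le> M" unfolding M_def using fin by (intro Max_ge) auto
    then show ?thesis using N that by force
  qed simp
  moreover have "1 \<le> M" unfolding M_def using fin by (intro Max_ge) auto
  ultimately show thesis using that by metis
qed

section \<open>Invariants of the tensor products with
  \<open>A(\<alpha>,\<beta>,\<gamma>)\<close>\<close>

lemma tensA_iso_imp:
  fixes sc :: "complex \<Rightarrow> 'a::ab_group_add \<Rightarrow> 'a" and sc1 :: "complex \<Rightarrow> 'b::ab_group_add \<Rightarrow> 'b"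
  assumes L: "is_L sc \<rho> c h l" and L1: "is_L sc1 \<rho>1 c1 h1 l1"
    and \<gamma>: "\<gamma> \<noteq> 0" "\<gamma>1 \<noteq> 0"
    and iso: "mod_iso tensA_carrier (fsc sc) (tensA_act sc \<rho> \<alpha> \<beta> \<gamma>)
      tensA_carrier (fsc sc1) (tensA_act sc1 \<rho>1 \<alpha>1 \<beta>1 \<gamma>1)"
  shows "(\<beta>, \<gamma>, c, h, l) = (\<beta>1, \<gamma>1, c1, h1, l1) \<and> 2 * (\<alpha> - \<alpha>1) \<in> \<int>"
proof -
  interpret L: D_irreducible sc \<rho> by (rule is_L_irreducible[OF L])
  interpret L1: D_irreducible sc1 \<rho>1 by (rule is_L_irreducible[OF L1])
  obtain v where hw: "hw_vector sc \<rho> c h l v" using L by (auto simp: is_L_def)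
  obtain v1 where hw1: "hw_vector sc1 \<rho>1 c1 h1 l1 v1" using L1 by (auto simp: is_L_def)
  have v: "v \<noteq> 0" "\<rho> (Dd 0) v = sc h v" "\<rho> Dc v = sc c v" "\<rho> Dl v = sc l v"
    "\<And>n. 0 < n \<Longrightarrow> \<rho> (Dd n) v = 0" "\<And>k. 0 \<le> k \<Longrightarrow> \<rho> (Dh k) v = 0"
    using hw by (auto simp: hw_vector_def)
  define A where "A = tensA_act sc \<rho> \<alpha> \<beta> \<gamma>"
  define A1 where "A1 = tensA_act sc1 \<rho>1 \<alpha>1 \<beta>1 \<gamma>1"
  define e where "e k = (if even k then 1 else \<gamma>)" for k :: int
  define e1 where "e1 k = (if even k then 1 else \<gamma>1)" for k :: int
  define x where "x k a = pure_tensor k (sc a v)" for k a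
  have x_mem: "x k a \<in> supp_on UNIV" for k a unfolding x_def by (rule pure_tensor_supp_on) simp
  obtain \<phi> where \<phi>: "\<And>x. x \<in> supp_on UNIV \<Longrightarrow> \<phi> x \<in> supp_on UNIV"
    "\<And>x. x \<in> supp_on UNIV \<Longrightarrow> \<phi> x = 0 \<Longrightarrow> x = 0" "\<phi> 0 = 0"
    "\<And>a x. x \<in> supp_on UNIV \<Longrightarrow> \<phi> (fsc sc a x) = fsc sc1 a (\<phi> x)"
    "\<And>g x. x \<in> supp_on UNIV \<Longrightarrow> \<phi> (A g x) = A1 g (\<phi> x)"
    using mod_isoE[OF iso[unfolded tensA_carrier_supp_on] zero_supp_on] unfolding A_def A1_def by blast
  define y where "y k = \<phi> (x k 1)" for k
  have \<phi>_x: "\<phi> (x k a) = fsc sc1 a (y k)" for k a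
  proof -
    have "x k a = fsc sc a (x k 1)" by (auto simp: x_def pure_tensor_def fsc_def)
    then show ?thesis unfolding y_def using \<phi>(4)[OF x_mem] by metis
  qed
  have A_Dh: "A (Dh r) (x k a) = x (k + (2 * r + 1)) (e k * a)" if "0 \<le> r" for r k a
    using v(6)[OF that] by (auto simp: A_def tensA_act_def x_def pure_tensor_def e_def)
  have A_Dd: "A (Dd m) (x k a) = x (k + 2 * m) ((\<alpha> + \<beta> * of_int m - of_int k / 2) * a)"
    if "0 < m" for m k a
    using v(5)[OF that] by (auto simp: A_def tensA_act_def x_def pure_tensor_def)
  have A1_Dh: "A1 (Dh r) f i = \<rho>1 (Dh r) (f i) + sc1 (e1 (i - (2 * r + 1))) (f (i - (2 * r + 1)))"
    for r f i by (simp add: A1_def tensA_act_def e1_def)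
  have A1_Dd: "A1 (Dd m) f i = \<rho>1 (Dd m) (f i)
      + sc1 (\<alpha>1 + \<beta>1 * of_int m - of_int (i - 2 * m) / 2) (f (i - 2 * m))"
    for m f i by (simp add: A1_def tensA_act_def)
  have y_nonzero: "\<exists>j. y k j \<noteq> 0" for k
  proof (rule ccontr)
    assume "\<not> (\<exists>j. y k j \<noteq> 0)"
    then have "y k = 0" by auto
    then have "x k 1 = 0" using \<phi>(2)[OF x_mem] by (simp add: y_def)
    then have "x k 1 k = 0" by simp
    then show False using v(1) by (simp add: x_def pure_tensor_def)
  qed
  have "\<exists>N. 1 \<le> N \<and> (\<forall>g i. N \<le> ddeg g \<longrightarrow> \<rho>1 g (y k i) = 0)" for k
    unfolding y_def by (rule L1.hw_nilpotent_family[OF hw1 \<phi>(1)[OF x_mem, of k 1]]) blast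
  then obtain N where N: "\<And>k. 1 \<le> N k" "\<And>k g i. N k \<le> ddeg g \<Longrightarrow> \<rho>1 g (y k i) = 0"
    by metis
  have supp: "\<beta> = \<beta>1 \<and> \<alpha> - of_int k / 2 = \<alpha>1 - of_int j / 2" if j: "y k j \<noteq> 0" for k j
  proof -
    define r where "r = N k"
    have r: "1 \<le> r" using N(1) by (simp add: r_def)
    \<comment> \<open>On \<open>x k 1\<close>, \<open>d_m h_r\<close> is a scalar \<open>?a\<close>
      times \<open>h_(m+r)\<close>, as the parity factor \<open>e k\<close> occurs on both sides. In
      the image, the component at the shifted index comes from \<open>y k j\<close> alone, with the
      common factor \<open>e1 j\<close>, and comparing the scalars gives the equation.\<close>
    have coeff: "\<alpha>1 + \<beta>1 * of_int m - of_int (j + 2 * r + 1) / 2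
        = \<alpha> + \<beta> * of_int m - of_int (k + 2 * r + 1) / 2" if m: "r \<le> m" for m
    proof -
      let ?a = "\<alpha> + \<beta> * of_int m - of_int (k + 2 * r + 1) / 2"
      have "A (Dd m) (A (Dh r) (x k 1)) = fsc sc ?a (A (Dh (m + r)) (x k 1))"
        using r m by (simp add: A_Dh A_Dd) (simp add: x_def pure_tensor_def fsc_def fun_eq_iff algebra_simps)
      moreover have "A (Dh s) (x k 1) \<in> supp_on UNIV" if "0 \<le> s" for s
        using that by (simp add: A_Dh x_mem)
      ultimately have "A1 (Dd m) (A1 (Dh r) (y k)) = fsc sc1 ?a (A1 (Dh (m + r)) (y k))"
        using r m x_mem by (simp add: y_def \<phi>(4) flip: \<phi>(5))
      then have "A1 (Dd m) (A1 (Dh r) (y k)) (j + (2 * r + 1) + 2 * m)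
        = sc1 ?a (A1 (Dh (m + r)) (y k) (j + (2 * r + 1) + 2 * m))"
        by (simp only: fsc_def)
      moreover have van: "\<rho>1 g (y k i) = 0" if "g = Dd m \<or> g = Dh r \<or> g = Dh (m + r)" for g i
        using that r m by (intro N(2)) (auto simp: r_def)
      have "A1 (Dd m) (A1 (Dh r) (y k)) (j + (2 * r + 1) + 2 * m)
        = sc1 ((\<alpha>1 + \<beta>1 * of_int m - of_int (j + (2 * r + 1)) / 2) * e1 j) (y k j)"
        unfolding A1_Dd A1_Dh by (simp only: van L1.act_add L1.act_scale L1.act_zero L1.scale_zero_right
            add_diff_cancel_right' L1.scale_scale add_0 simp_thms)
      moreover have "j + (2 * r + 1) + 2 * m - (2 * (m + r) + 1) = j" by simp
      then have "A1 (Dh (m + r)) (y k) (j + (2 * r + 1) + 2 * m) = sc1 (e1 j) (y k j)"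
        unfolding A1_Dh by (simp only: van simp_thms add_0)
      moreover have "e1 j \<noteq> 0" using \<gamma> by (simp add: e1_def)
      ultimately show ?thesis using j by (simp add: add.assoc)
    qed
    \<comment> \<open>The equation is affine in \<open>m\<close>; two consecutive values determine
      the slope.\<close>
    have "\<beta> = \<beta>1"
      using coeff[OF order_refl] coeff[of "r + 1"] unfolding of_int_add of_int_1 by simp algebra
    then show ?thesis using coeff[OF order_refl] by (simp add: add_divide_distrib algebra_simps)
  qed
  have \<beta>: "\<beta> = \<beta>1" using y_nonzero[of 0] supp by blast
  obtain j where j: "y 0 j \<noteq> 0" using y_nonzero by blast
  \<comment> \<open>Two \<open>h\<close>'s pass through one even and one odd index, so
    \<open>h_r h_s\<close> contributes the factor \<open>\<gamma>\<close> for either parity of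
    \<open>k\<close>. It is compared with the \<open>d_m\<close> of the same degree,
    \<open>m = r + s + 1\<close> in the integer indexing of \<open>Dh\<close>, whose scalar is the
    same on both sides by \<open>supp\<close>.\<close>
  have "\<gamma> = \<gamma>1"
  proof -
    \<comment> \<open>With a nonzero constant term, the scalar of \<open>d_m\<close> is not
      identically zero as an affine function of \<open>m\<close>. It is therefore nonzero for
      \<open>s = r\<close> or for \<open>s = r + 1\<close>, and can be cancelled at the end.\<close>
    obtain k :: int where k: "\<alpha> - of_int k / 2 \<noteq> 0"
      by (cases "\<alpha> = 0") (auto intro: that[of 1] that[of 0])
    obtain j where j: "y k j \<noteq> 0" using y_nonzero by blast
    define r where "r = N k"
    have r: "1 \<le> r" using N(1) by (simp add: r_def)
    obtain s where s: "r \<le> s" "\<alpha> + \<beta> * of_int (r + s + 1) - of_int k / 2 \<noteq> 0"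
    proof (cases "\<alpha> + \<beta> * of_int (r + r + 1) - of_int k / 2 = 0")
      case True
      then have "\<alpha> + \<beta> * of_int (r + (r + 1) + 1) - of_int k / 2 = \<beta>" by (simp add: algebra_simps)
      moreover have "\<beta> \<noteq> 0" using True k by auto
      ultimately show thesis by (intro that[of "r + 1"]) auto
    qed (auto intro: that)
    let ?m = "r + s + 1"
    let ?a = "\<alpha> + \<beta> * of_int ?m - of_int k / 2"
    have "fsc sc ?a (A (Dh r) (A (Dh s) (x k 1))) = fsc sc \<gamma> (A (Dd ?m) (x k 1))"
      using r s(1) by (simp add: A_Dh A_Dd)
        (auto simp: x_def pure_tensor_def fsc_def fun_eq_iff algebra_simps e_def)
    moreover have "A (Dh s) (x k 1) \<in> supp_on UNIV" "A (Dh r) (A (Dh s) (x k 1)) \<in> supp_on UNIV"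
      "A (Dd ?m) (x k 1) \<in> supp_on UNIV"
      using r s by (simp_all add: A_Dh A_Dd x_mem)
    ultimately have "fsc sc1 ?a (A1 (Dh r) (A1 (Dh s) (y k))) = fsc sc1 \<gamma> (A1 (Dd ?m) (y k))"
      by (simp add: y_def x_mem flip: \<phi>(4,5))
    then have "sc1 ?a (A1 (Dh r) (A1 (Dh s) (y k)) (j + 2 * ?m)) = sc1 \<gamma> (A1 (Dd ?m) (y k) (j + 2 * ?m))"
      by (simp only: fsc_def fun_eq_iff)
    moreover have "\<rho>1 g (y k i) = 0" if "g = Dd ?m \<or> g = Dh r \<or> g = Dh s" for g i
      using that r s by (intro N(2)) (auto simp: r_def)
    moreover have "j + 2 * ?m - (2 * r + 1) = j + (2 * s + 1)" by simp
    moreover have "e1 (j + (2 * s + 1)) * e1 j = \<gamma>1" by (simp add: e1_def)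
    ultimately have "sc1 (?a * \<gamma>1) (y k j)
        = sc1 (\<gamma> * (\<alpha>1 + \<beta>1 * of_int ?m - of_int j / 2)) (y k j)"
      by (simp add: A1_Dd A1_Dh)
    then have "?a * \<gamma>1 = \<gamma> * (\<alpha>1 + \<beta>1 * of_int ?m - of_int j / 2)" using j by simp
    moreover have "\<alpha>1 + \<beta>1 * of_int ?m - of_int j / 2 = ?a" using supp[OF j] by (simp add: algebra_simps)
    ultimately show ?thesis using s(2) by simp
  qed
  moreover have "2 * (\<alpha> - \<alpha>1) \<in> \<int>"
  proof -
    have "\<alpha> = \<alpha>1 - of_int j / 2" using supp[OF j] by simp
    then have "2 * (\<alpha> - \<alpha>1) = of_int (- j)" by simp
    then show ?thesis by (metis Ints_of_int)
  qed
  moreover have "hw_vector sc1 \<rho>1 c h l (y 0 j)"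
  proof -
    have supp0: "y k i = 0" if "i \<noteq> j + k" for i k
    proof (rule ccontr)
      assume nz: "y k i \<noteq> 0"
      have "of_int i = (of_int (j + k) :: complex)" 
        using supp[OF nz, THEN conjunct2] supp[OF j, THEN conjunct2] unfolding of_int_add of_int_0
        by algebra
      then show False using that by (simp only: of_int_eq_iff)
    qed
    \<comment> \<open>Comparison at index \<open>j\<close>. For \<open>g\<close> of positive degree,
      the left side is supported at \<open>j + ddeg g\<close> and the second-factor term on the
      right vanishes at \<open>j\<close>, so only \<open>\<rho>1 g (y 0 j)\<close> remains and must
      be \<open>0\<close>. For \<open>d_0\<close> the second factors contribute the equal scalars
      \<open>\<alpha>\<close> and \<open>\<alpha>1 - j / 2\<close>, which leaves
      \<open>h\<close>.\<close>
    have act: "\<phi> (A g (x 0 1)) j = A1 g (y 0) j" for g unfolding y_def \<phi>(5)[OF x_mem] ..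
    have "\<rho>1 (Dd n) (y 0 j) = 0" if "0 < n" for n
      using act[of "Dd n"] that by (simp add: A_Dd A1_Dd \<phi>_x fsc_def supp0)
    moreover have "\<rho>1 (Dh r) (y 0 j) = 0" if "0 \<le> r" for r
      using act[of "Dh r"] that by (simp add: A_Dh A1_Dh \<phi>_x fsc_def supp0)
    moreover have "\<rho>1 (Dd 0) (y 0 j) = sc1 h (y 0 j)"
    proof -
      have "A (Dd 0) (x 0 1) = x 0 (h + \<alpha>)"
        using v(2) by (auto simp: A_def tensA_act_def x_def pure_tensor_def L.scale_left_distrib)
      then show ?thesis using act[of "Dd 0"] supp[OF j]
        by (simp add: \<phi>_x fsc_def A1_Dd L1.scale_left_distrib)
    qed
    moreover have "\<rho>1 Dc (y 0 j) = sc1 c (y 0 j)"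
    proof -
      have "A Dc (x 0 1) = x 0 c"
        using v(3) by (auto simp: A_def tensA_act_def x_def pure_tensor_def)
      then show ?thesis using act[of Dc] by (simp add: \<phi>_x fsc_def A1_def tensA_act_def)
    qed
    moreover have "\<rho>1 Dl (y 0 j) = sc1 l (y 0 j)"
    proof -
      have "A Dl (x 0 1) = x 0 l"
        using v(4) by (auto simp: A_def tensA_act_def x_def pure_tensor_def)
      then show ?thesis using act[of Dl] by (simp add: \<phi>_x fsc_def A1_def tensA_act_def)
    qed
    ultimately show ?thesis using j by (simp add: hw_vector_def)
  qed
  then have "(c, h, l) = (c1, h1, l1)" using hw1 by (rule L1.hw_unique)
  ultimately show ?thesis using \<beta> by simp
qed

section \<open>Separation of the two families\<close>

text \<open>In the product with \<open>A'\<close> the Heisenberg part acts on the first factor only,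
  so every vector is killed by \<open>h_r\<close> for large \<open>r\<close>. In the product with
  \<open>A\<close> such an \<open>h_r\<close> moves \<open>v\<close> from index \<open>0\<close> to
  another index with coefficient \<open>1\<close>.\<close>

lemma tensA_not_iso_tensA':
  fixes sc :: "complex \<Rightarrow> 'a::ab_group_add \<Rightarrow> 'a" and sc1 :: "complex \<Rightarrow> 'b::ab_group_add \<Rightarrow> 'b"
  assumes L: "is_L sc \<rho> c h l" and L1: "is_L sc1 \<rho>1 c1 h1 l1"
  shows "\<not> mod_iso tensA_carrier (fsc sc) (tensA_act sc \<rho> \<alpha> \<beta> \<gamma>)
    (tensA'_carrier \<alpha>1 \<beta>1) (fsc sc1) (tensA'_act sc1 \<rho>1 \<alpha>1 \<beta>1)"
proof
  assume iso: "mod_iso tensA_carrier (fsc sc) (tensA_act sc \<rho> \<alpha> \<beta> \<gamma>)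
    (tensA'_carrier \<alpha>1 \<beta>1) (fsc sc1) (tensA'_act sc1 \<rho>1 \<alpha>1 \<beta>1)"
  interpret L: D_irreducible sc \<rho> by (rule is_L_irreducible[OF L])
  interpret L1: D_irreducible sc1 \<rho>1 by (rule is_L_irreducible[OF L1])
  obtain v where hw: "hw_vector sc \<rho> c h l v" using L by (auto simp: is_L_def)
  obtain v1 where hw1: "hw_vector sc1 \<rho>1 c1 h1 l1 v1" using L1 by (auto simp: is_L_def)
  define x where "x = pure_tensor 0 v"
  have x_mem: "x \<in> supp_on UNIV" unfolding x_def by (rule pure_tensor_supp_on) simp
  define A where "A = tensA_act sc \<rho> \<alpha> \<beta> \<gamma>"
  define A1 where "A1 = tensA'_act sc1 \<rho>1 \<alpha>1 \<beta>1"
  obtain \<phi> where \<phi>: "\<And>x. x \<in> supp_on UNIV \<Longrightarrow> \<phi> x \<in> supp_on (Aprime_index \<alpha>1 \<beta>1)"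
    "\<And>x. x \<in> supp_on UNIV \<Longrightarrow> \<phi> x = 0 \<Longrightarrow> x = 0" "\<phi> 0 = 0"
    "\<And>a x. x \<in> supp_on UNIV \<Longrightarrow> \<phi> (fsc sc a x) = fsc sc1 a (\<phi> x)"
    "\<And>g x. x \<in> supp_on UNIV \<Longrightarrow> \<phi> (A g x) = A1 g (\<phi> x)"
    using mod_isoE[OF iso[unfolded tensA_carrier_supp_on tensA'_carrier_supp_on] zero_supp_on]
    unfolding A_def A1_def by blast
  obtain N where N: "1 \<le> N" "\<And>g i. N \<le> ddeg g \<Longrightarrow> \<rho>1 g (\<phi> x i) = 0"
    using L1.hw_nilpotent_family[OF hw1 \<phi>(1)[OF x_mem]] by metis
  have Ax: "A (Dh N) x = pure_tensor (2 * N + 1) v"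
    using hw N(1) by (auto simp: A_def tensA_act_def x_def pure_tensor_def hw_vector_def)
  then have mem: "A (Dh N) x \<in> supp_on UNIV" by (simp add: pure_tensor_supp_on)
  have "A1 (Dh N) (\<phi> x) = 0"
    using N(1) by (auto simp: A1_def tensA'_act_def fun_eq_iff N(2))
  then have "A (Dh N) x = 0" using \<phi>(2)[OF mem] \<phi>(5)[OF x_mem] by simp
  then have "pure_tensor (2 * N + 1) v (2 * N + 1) = 0" by (simp add: Ax)
  then show False using hw by (simp add: pure_tensor_def hw_vector_def)
qed

section \<open>Invariants of the tensor products with \<open>A'(\<alpha>,\<beta>)\<close>\<close>

lemma quadratic_vanishes_eventually:
  fixes a b c :: complex
  assumes "\<And>m::int. N \<le> m \<Longrightarrow> a * (of_int m)^2 + b * of_int m + c = 0"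
  shows "a = 0 \<and> b = 0 \<and> c = 0"
proof -
  define t where "t = (of_int N :: complex)"
  have *: "a * t^2 + b * t + c = 0" "a * (t + 1)^2 + b * (t + 1) + c = 0"
    "a * (t + 2)^2 + b * (t + 2) + c = 0"
    using assms[of N] assms[of "N + 1"] assms[of "N + 2"] by (simp_all add: t_def)
  \<comment> \<open>The second difference of three consecutive values isolates \<open>2 * a\<close>;
    the first difference then gives \<open>b\<close>.\<close>
  have "2 * a = (a * (t + 2)^2 + b * (t + 2) + c) - 2 * (a * (t + 1)^2 + b * (t + 1) + c)
    + (a * t^2 + b * t + c)" by (simp add: algebra_simps power2_eq_square)
  then have a: "a = 0" by (simp only: *) simp
  then have "b = (a * (t + 1)^2 + b * (t + 1) + c) - (a * t^2 + b * t + c)"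
    by (simp add: algebra_simps)
  then have "b = 0" by (simp only: *) simp
  then show ?thesis using a * by simp
qed

text \<open>The hypothesis is the condition that the relation between \<open>d\<^sub>n d\<^sub>m v\<^sub>k\<close> and \<open>d\<^bsub>m+n\<^esub> v\<^sub>k\<close> is the same
  in two modules of the intermediate series, with \<open>a = \<alpha> - k\<close> and \<open>b = \<alpha>1 - j\<close>.\<close>

lemma intermediate_series_parameters:
  fixes a b \<beta> \<beta>1 :: complex
  assumes eq: "\<And>m n::int. N \<le> m \<Longrightarrow> N \<le> n \<Longrightarrow>
      (a + \<beta> * of_int (m + n)) * ((b + \<beta>1 * of_int m) * (b + \<beta>1 * of_int n - of_int m))
      = (a + \<beta> * of_int m) * (a + \<beta> * of_int n - of_int m) * (b + \<beta>1 * of_int (m + n))"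
    and a: "a = 0 \<Longrightarrow> \<beta> \<noteq> 0 \<and> \<beta> \<noteq> -1" and b: "b = 0 \<Longrightarrow> \<beta>1 \<noteq> 0 \<and> \<beta>1 \<noteq> -1"
  shows "a = b \<and> (\<beta> = \<beta>1 \<or> {\<beta>, \<beta>1} = {0, -1})"
proof -
  \<comment> \<open>Coefficients of the left side minus the right side as a polynomial in
    \<open>m\<close> and \<open>n\<close>: \<open>s\<close> belongs to \<open>m^2 n\<close> and
    \<open>m n^2\<close>, \<open>q\<close> to \<open>m^2\<close> and \<open>n^2\<close>,
    \<open>t\<close> to \<open>m n\<close>, \<open>u\<close> to \<open>m\<close> and
    \<open>n\<close>, and \<open>w\<close> is the constant term. They are shown to vanish by fixing
    \<open>n\<close> and varying \<open>m\<close>, then varying \<open>n\<close>.\<close>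
  define s where "s = \<beta> * \<beta>1 * (\<beta>1 - \<beta>)"
  define q where "q = \<beta> * \<beta>1 * (b - a)"
  define t where "t = a * \<beta>1^2 - b * \<beta>^2 - b * \<beta> + a * \<beta>1 + 2 * (b - a) * \<beta> * \<beta>1"
  define u where "u = b * (a * \<beta>1 + \<beta> * b) - a * (b * \<beta> + \<beta>1 * a)"
  define w where "w = a * b * (b - a)"
  have "s * of_int n + q = 0 \<and> s * (of_int n)^2 + t * of_int n + u = 0
      \<and> q * (of_int n)^2 + u * of_int n + w = 0" if n: "N \<le> n" for n
  proof (rule quadratic_vanishes_eventually[of N])
    fix m :: int assume m: "N \<le> m"
    show "(s * of_int n + q) * (of_int m)^2 + (s * (of_int n)^2 + t * of_int n + u) * of_int m
      + (q * (of_int n)^2 + u * of_int n + w) = 0"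
      using eq[OF m n] unfolding s_def q_def t_def u_def w_def of_int_add by algebra
  qed
  then have z: "s = 0" "t = 0" "u = 0" "q = 0" "w = 0"
    using quadratic_vanishes_eventually[of N s t u] quadratic_vanishes_eventually[of N q u w]
    by simp_all
  \<comment> \<open>If both are nonzero, \<open>s\<close> and \<open>q\<close> decide. If both are
    zero, \<open>w\<close> does, as \<open>a\<close> and \<open>b\<close> are then nonzero. If
    exactly one is zero, \<open>t\<close> forces the other to be \<open>-1\<close> and
    \<open>u\<close> gives \<open>a = b\<close>.\<close>
  consider "\<beta> \<noteq> 0" "\<beta>1 \<noteq> 0" | "\<beta> = 0" "\<beta>1 = 0" | "\<beta> = 0" "\<beta>1 \<noteq> 0" | "\<beta> \<noteq> 0" "\<beta>1 = 0"
    by blast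
  then show ?thesis
  proof cases
    case 1
    then show ?thesis using z by (simp add: s_def q_def)
  next
    case 2
    then show ?thesis using a b z(5) by (auto simp: w_def)
  next
    case 3
    then have "a \<noteq> 0" using a by blast
    moreover have "a * \<beta>1 * (\<beta>1 + 1) = 0" using z(2) 3 unfolding t_def by algebra
    ultimately show ?thesis using 3 z(3) by (auto simp: u_def add_eq_0_iff2)
  next
    case 4
    then have "b \<noteq> 0" using b by blast
    moreover have "b * \<beta> * (\<beta> + 1) = 0" using z(2) 4 unfolding t_def by algebra
    ultimately show ?thesis using 4 z(3) by (auto simp: u_def add_eq_0_iff2)
  qed
qed

lemma Aprime_index_eventually:
  obtains N where "\<And>i. N \<le> i \<Longrightarrow> i \<in> Aprime_index \<alpha> \<beta>"
proof (cases "\<alpha> \<in> \<int>")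
  case True
  then obtain k where "\<alpha> = of_int k" by (auto elim: Ints_cases)
  then show thesis by (intro that[of "k + 1"]) (auto simp: Aprime_index_def)
next
  case False
  then show thesis by (intro that[of 0]) (auto simp: Aprime_index_def)
qed

lemma tensA'_iso_imp:
  fixes sc :: "complex \<Rightarrow> 'a::ab_group_add \<Rightarrow> 'a" and sc1 :: "complex \<Rightarrow> 'b::ab_group_add \<Rightarrow> 'b"
  assumes L: "is_L sc \<rho> c h l" and L1: "is_L sc1 \<rho>1 c1 h1 l1"
    and iso: "mod_iso (tensA'_carrier \<alpha> \<beta>) (fsc sc) (tensA'_act sc \<rho> \<alpha> \<beta>)
      (tensA'_carrier \<alpha>1 \<beta>1) (fsc sc1) (tensA'_act sc1 \<rho>1 \<alpha>1 \<beta>1)"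
  shows "(c, h, l) = (c1, h1, l1) \<and> \<alpha> - \<alpha>1 \<in> \<int> \<and> (\<beta> = \<beta>1 \<or> {\<beta>, \<beta>1} = {0, -1})"
proof -
  interpret L: D_irreducible sc \<rho> by (rule is_L_irreducible[OF L])
  interpret L1: D_irreducible sc1 \<rho>1 by (rule is_L_irreducible[OF L1])
  obtain v where hw: "hw_vector sc \<rho> c h l v" using L by (auto simp: is_L_def)
  obtain v1 where hw1: "hw_vector sc1 \<rho>1 c1 h1 l1 v1" using L1 by (auto simp: is_L_def)
  have v: "v \<noteq> 0" "\<rho> (Dd 0) v = sc h v" "\<rho> Dc v = sc c v" "\<rho> Dl v = sc l v"
    "\<And>n. 0 < n \<Longrightarrow> \<rho> (Dd n) v = 0" "\<And>k. 0 \<le> k \<Longrightarrow> \<rho> (Dh k) v = 0"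
    using hw by (auto simp: hw_vector_def)
  define I where "I = Aprime_index \<alpha> \<beta>"
  define I1 where "I1 = Aprime_index \<alpha>1 \<beta>1"
  define A where "A = tensA'_act sc \<rho> \<alpha> \<beta>"
  define A1 where "A1 = tensA'_act sc1 \<rho>1 \<alpha>1 \<beta>1"
  define x where "x k a = pure_tensor k (sc a v)" for k a
  have x_mem: "x k a \<in> supp_on I" if "k \<in> I" for k a
    unfolding x_def by (rule pure_tensor_supp_on[OF that])
  obtain \<phi> where \<phi>: "\<And>x. x \<in> supp_on I \<Longrightarrow> \<phi> x \<in> supp_on I1"
    "\<And>x. x \<in> supp_on I \<Longrightarrow> \<phi> x = 0 \<Longrightarrow> x = 0" "\<phi> 0 = 0"
    "\<And>a x. x \<in> supp_on I \<Longrightarrow> \<phi> (fsc sc a x) = fsc sc1 a (\<phi> x)"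
    "\<And>g x. x \<in> supp_on I \<Longrightarrow> \<phi> (A g x) = A1 g (\<phi> x)"
    using mod_isoE[OF iso[unfolded tensA'_carrier_supp_on] zero_supp_on]
    unfolding A_def A1_def I_def I1_def by blast
  define y where "y k = \<phi> (x k 1)" for k
  have y_mem: "y k \<in> supp_on I1" if "k \<in> I" for k
    unfolding y_def by (rule \<phi>(1)[OF x_mem[OF that]])
  have \<phi>_x: "\<phi> (x k a) = fsc sc1 a (y k)" if "k \<in> I" for k a
  proof -
    have "x k a = fsc sc a (x k 1)" by (auto simp: x_def pure_tensor_def fsc_def)
    then show ?thesis unfolding y_def using \<phi>(4)[OF x_mem[OF that]] by metis
  qed
  have A_Dd: "A (Dd m) (x k a)
      = (if k + m \<in> I then x (k + m) ((\<alpha> + \<beta> * of_int m - of_int k) * a) else 0)"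
    if "0 < m" for m k a
    using v(5)[OF that] by (auto simp: A_def tensA'_act_def x_def pure_tensor_def I_def fun_eq_iff)
  have A1_Dd: "A1 (Dd m) f i = (if i \<in> I1 then \<rho>1 (Dd m) (f i)
      + sc1 (\<alpha>1 + \<beta>1 * of_int m - of_int (i - m)) (f (i - m)) else 0)"
    for m f i by (simp add: A1_def tensA'_act_def I1_def)
  have y_nonzero: "\<exists>j. y k j \<noteq> 0" if "k \<in> I" for k
  proof (rule ccontr)
    assume "\<not> (\<exists>j. y k j \<noteq> 0)"
    then have "y k = 0" by auto
    then have "x k 1 = 0" using \<phi>(2)[OF x_mem[OF that]] by (simp add: y_def)
    then have "x k 1 k = 0" by simp
    then show False using v(1) by (simp add: x_def pure_tensor_def)
  qed
  have supp: "\<alpha> - of_int k = \<alpha>1 - of_int j \<and> (\<beta> = \<beta>1 \<or> {\<beta>, \<beta>1} = {0, -1})"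
    if k: "k \<in> I" and j: "y k j \<noteq> 0" for k j
  proof -
    have j_I1: "j \<in> I1" using y_mem[OF k] j by (auto simp: supp_on_def)
    obtain N where N: "1 \<le> N" "\<And>g i. N \<le> ddeg g \<Longrightarrow> \<rho>1 g (y k i) = 0"
      using L1.hw_nilpotent_family[OF hw1 y_mem[OF k]] by metis
    obtain K where K: "\<And>i. K \<le> i \<Longrightarrow> i \<in> I" using Aprime_index_eventually unfolding I_def by metis
    obtain K1 where K1: "\<And>i. K1 \<le> i \<Longrightarrow> i \<in> I1" using Aprime_index_eventually unfolding I1_def by metis
    \<comment> \<open>Beyond \<open>M\<close> the generators kill all components of
      \<open>y k\<close>, and the indices reached from \<open>k\<close> and \<open>j\<close> lie
      past any removed index.\<close>
    define M where "M = max N (max (K - k) (K1 - j))"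
    show ?thesis
    proof (rule intermediate_series_parameters[of M])
      fix m n assume m: "M \<le> m" and n: "M \<le> n"
      have pos: "0 < m" "0 < n" using N(1) m n by (auto simp: M_def)
      have mem: "k + m \<in> I" "k + m + n \<in> I" "k + (m + n) \<in> I" "j + m \<in> I1" "j + m + n \<in> I1"
        using m n pos by (auto simp: M_def intro!: K K1)
      let ?a = "\<alpha> - of_int k + \<beta> * of_int (m + n)"
      let ?b = "(\<alpha> - of_int k + \<beta> * of_int m) * (\<alpha> - of_int k + \<beta> * of_int n - of_int m)"
      \<comment> \<open>Both \<open>d_n d_m\<close> and \<open>d_(m+n)\<close> send
        \<open>x k 1\<close> to multiples of the same simple tensor, with scalars \<open>?b\<close>
        and \<open>?a\<close>; cross-multiplying avoids dividing by a scalar that may be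
        zero.\<close>
      have "fsc sc ?a (A (Dd n) (A (Dd m) (x k 1))) = fsc sc ?b (A (Dd (m + n)) (x k 1))"
        using pos mem by (simp add: A_Dd)
          (auto simp: x_def pure_tensor_def fsc_def fun_eq_iff algebra_simps)
      moreover have "A (Dd n) (A (Dd m) (x k 1)) \<in> supp_on I" "A (Dd m) (x k 1) \<in> supp_on I"
        "A (Dd (m + n)) (x k 1) \<in> supp_on I"
        using pos mem by (simp_all add: A_Dd x_mem)
      ultimately have "fsc sc1 ?a (A1 (Dd n) (A1 (Dd m) (y k))) = fsc sc1 ?b (A1 (Dd (m + n)) (y k))"
        unfolding y_def using x_mem[OF k] by (metis \<phi>(4,5))
      then have "sc1 ?a (A1 (Dd n) (A1 (Dd m) (y k)) (j + m + n))
        = sc1 ?b (A1 (Dd (m + n)) (y k) (j + m + n))"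
        by (simp only: fsc_def fun_eq_iff)
      moreover have van: "\<rho>1 g (y k i) = 0" if "g = Dd m \<or> g = Dd n \<or> g = Dd (m + n)" for g i
        using that pos m n by (intro N(2)) (auto simp: M_def)
      have "A1 (Dd m) (y k) (j + m) = sc1 (\<alpha>1 + \<beta>1 * of_int m - of_int j) (y k j)"
        using mem by (simp add: A1_Dd van)
      moreover have "\<rho>1 (Dd n) (A1 (Dd m) (y k) i) = 0" for i
        by (simp add: A1_Dd van)
      then have "A1 (Dd n) (A1 (Dd m) (y k)) (j + m + n)
        = sc1 (\<alpha>1 + \<beta>1 * of_int n - of_int (j + m)) (A1 (Dd m) (y k) (j + m))"
        using mem by (simp add: A1_Dd[of n])
      moreover have "j + m + n - (m + n) = j" by simp
      then have "A1 (Dd (m + n)) (y k) (j + m + n) = sc1 (\<alpha>1 + \<beta>1 * of_int (m + n) - of_int j) (y k j)"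
        using mem unfolding A1_Dd by (simp only: van simp_thms if_True add_0)
      ultimately have "?a * ((\<alpha>1 + \<beta>1 * of_int n - of_int (j + m)) * (\<alpha>1 + \<beta>1 * of_int m - of_int j))
        = ?b * (\<alpha>1 + \<beta>1 * of_int (m + n) - of_int j)"
        using j by (simp only: L1.scale_scale L1.scale_cancel_right) simp
      then show "?a * ((\<alpha>1 - of_int j + \<beta>1 * of_int m) * (\<alpha>1 - of_int j + \<beta>1 * of_int n - of_int m))
        = ?b * (\<alpha>1 - of_int j + \<beta>1 * of_int (m + n))"
        by (simp add: algebra_simps)
    next
      show "\<beta> \<noteq> 0 \<and> \<beta> \<noteq> -1" if "\<alpha> - of_int k = 0"
        using that k by (auto simp: I_def Aprime_index_def)
      show "\<beta>1 \<noteq> 0 \<and> \<beta>1 \<noteq> -1" if "\<alpha>1 - of_int j = 0"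
        using that j_I1 by (auto simp: I1_def Aprime_index_def)
    qed
  qed
  obtain k where k: "k \<in> I" using Aprime_index_eventually unfolding I_def by (metis order_refl)
  obtain j where j: "y k j \<noteq> 0" using y_nonzero[OF k] by blast
  have j_I1: "j \<in> I1" using y_mem[OF k] j by (auto simp: supp_on_def)
  have "\<alpha> - \<alpha>1 \<in> \<int>"
  proof -
    have "\<alpha> - \<alpha>1 = of_int (k - j)" using supp[OF k j] by (simp add: algebra_simps)
    then show ?thesis by (metis Ints_of_int)
  qed
  moreover have "hw_vector sc1 \<rho>1 c h l (y k j)"
  proof -
    have supp_shift: "y (k + n) i = 0" if "i \<noteq> j + n" "k + n \<in> I" for i n
    proof (rule ccontr)
      assume nz: "y (k + n) i \<noteq> 0"
      have "of_int i = (of_int (j + n) :: complex)"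
        using supp[OF that(2) nz, THEN conjunct1] supp[OF k j, THEN conjunct1]
        unfolding of_int_add by algebra
      then show False using that by (simp only: of_int_eq_iff)
    qed
    have supp_k: "y k i = 0" if "i \<noteq> j" for i using supp_shift[of i 0] that k by simp
    have act: "\<phi> (A g (x k 1)) j = A1 g (y k) j" for g unfolding y_def \<phi>(5)[OF x_mem[OF k]] ..
    \<comment> \<open>If \<open>k + n\<close> is a removed index, \<open>d_n\<close> kills
      \<open>x k 1\<close>; otherwise its image is supported at \<open>j + n\<close>. Either way the
      left side of \<open>act\<close> is \<open>0\<close> at \<open>j\<close>.\<close>
    have "\<rho>1 (Dd n) (y k j) = 0" if "0 < n" for n
      using act[of "Dd n"] that j_I1
      by (auto simp: A_Dd A1_Dd \<phi>_x fsc_def supp_shift supp_k \<phi>(3) split: if_splits)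
    moreover have "\<rho>1 (Dh r) (y k j) = 0" if "0 \<le> r" for r
    proof -
      have "A (Dh r) (x k 1) = 0"
        using v(6)[OF that] by (auto simp: A_def tensA'_act_def x_def pure_tensor_def fun_eq_iff)
      then show ?thesis using act[of "Dh r"] j_I1
        by (simp add: \<phi>(3) A1_def tensA'_act_def I1_def)
    qed
    moreover have "\<rho>1 (Dd 0) (y k j) = sc1 h (y k j)"
    proof -
      have "A (Dd 0) (x k 1) = x k (h + (\<alpha> - of_int k))"
        using v(2) k
        by (auto simp: A_def tensA'_act_def x_def pure_tensor_def I_def L.scale_left_distrib)
      then have "sc1 (h + (\<alpha> - of_int k)) (y k j)
        = \<rho>1 (Dd 0) (y k j) + sc1 (\<alpha>1 - of_int j) (y k j)"
        using act[of "Dd 0"] j_I1 by (simp add: \<phi>_x[OF k] fsc_def A1_Dd)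
      then show ?thesis using supp[OF k j] by (simp add: L1.scale_left_distrib)
    qed
    moreover have "\<rho>1 Dc (y k j) = sc1 c (y k j)"
    proof -
      have "A Dc (x k 1) = x k c"
        using v(3) k by (auto simp: A_def tensA'_act_def x_def pure_tensor_def I_def)
      then show ?thesis using act[of Dc] j_I1 by (simp add: \<phi>_x[OF k] fsc_def A1_def tensA'_act_def I1_def)
    qed
    moreover have "\<rho>1 Dl (y k j) = sc1 l (y k j)"
    proof -
      have "A Dl (x k 1) = x k l"
        using v(4) k by (auto simp: A_def tensA'_act_def x_def pure_tensor_def I_def)
      then show ?thesis using act[of Dl] j_I1 by (simp add: \<phi>_x[OF k] fsc_def A1_def tensA'_act_def I1_def)
    qed
    ultimately show ?thesis using j by (simp add: hw_vector_def)
  qed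
  then have "(c, h, l) = (c1, h1, l1)" using hw1 by (rule L1.hw_unique)
  ultimately show ?thesis using supp[OF k j] by simp
qed

theorem theorem4p4:
  fixes sc :: "complex \<Rightarrow> 'a::ab_group_add \<Rightarrow> 'a" and \<rho> :: "Dgen \<Rightarrow> 'a \<Rightarrow> 'a"
    and sc1 :: "complex \<Rightarrow> 'b::ab_group_add \<Rightarrow> 'b" and \<rho>1 :: "Dgen \<Rightarrow> 'b \<Rightarrow> 'b"
    and c h l \<alpha> \<beta> \<gamma> c1 h1 l1 \<alpha>1 \<beta>1 \<gamma>1 :: complex
  assumes L: "is_L sc \<rho> c h l"
    and L1: "is_L sc1 \<rho>1 c1 h1 l1"
    and "\<gamma> \<noteq> 0" and "\<gamma>1 \<noteq> 0"
  shows "(mod_iso (tensA'_carrier \<alpha> \<beta>) (fsc sc) (tensA'_act sc \<rho> \<alpha> \<beta>)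
             (tensA'_carrier \<alpha>1 \<beta>1) (fsc sc1) (tensA'_act sc1 \<rho>1 \<alpha>1 \<beta>1)
          \<longleftrightarrow> (c, h, l) = (c1, h1, l1) \<and> \<alpha> - \<alpha>1 \<in> \<int>
              \<and> (\<beta> = \<beta>1 \<or> {\<beta>, \<beta>1} = {0, -1}))
    \<and> (mod_iso tensA_carrier (fsc sc) (tensA_act sc \<rho> \<alpha> \<beta> \<gamma>)
             tensA_carrier (fsc sc1) (tensA_act sc1 \<rho>1 \<alpha>1 \<beta>1 \<gamma>1)
          \<longleftrightarrow> (\<beta>, \<gamma>, c, h, l) = (\<beta>1, \<gamma>1, c1, h1, l1) \<and> 2 * (\<alpha> - \<alpha>1) \<in> \<int>)
    \<and> \<not> mod_iso tensA_carrier (fsc sc) (tensA_act sc \<rho> \<alpha> \<beta> \<gamma>)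
             (tensA'_carrier \<alpha>1 \<beta>1) (fsc sc1) (tensA'_act sc1 \<rho>1 \<alpha>1 \<beta>1)"
proof (intro conjI iffI)
  assume "(c, h, l) = (c1, h1, l1) \<and> \<alpha> - \<alpha>1 \<in> \<int> \<and> (\<beta> = \<beta>1 \<or> {\<beta>, \<beta>1} = {0, -1})"
  then show "mod_iso (tensA'_carrier \<alpha> \<beta>) (fsc sc) (tensA'_act sc \<rho> \<alpha> \<beta>)
    (tensA'_carrier \<alpha>1 \<beta>1) (fsc sc1) (tensA'_act sc1 \<rho>1 \<alpha>1 \<beta>1)"
    using L L1 by (intro tensA'_iso[of sc \<rho> c h l]) auto
next
  assume "(\<beta>, \<gamma>, c, h, l) = (\<beta>1, \<gamma>1, c1, h1, l1) \<and> 2 * (\<alpha> - \<alpha>1) \<in> \<int>"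
  then show "mod_iso tensA_carrier (fsc sc) (tensA_act sc \<rho> \<alpha> \<beta> \<gamma>)
    tensA_carrier (fsc sc1) (tensA_act sc1 \<rho>1 \<alpha>1 \<beta>1 \<gamma>1)"
    using tensA_iso[OF L] L1 assms(3) by auto
next
  show "\<not> mod_iso tensA_carrier (fsc sc) (tensA_act sc \<rho> \<alpha> \<beta> \<gamma>)
    (tensA'_carrier \<alpha>1 \<beta>1) (fsc sc1) (tensA'_act sc1 \<rho>1 \<alpha>1 \<beta>1)"
    by (rule tensA_not_iso_tensA'[OF L L1])
qed (use tensA'_iso_imp[OF L L1] tensA_iso_imp[OF assms] in blast)+

end
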